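(* Let $d\ge1$, $0<\alpha<1$ and $\varepsilon>0$. Let $u_0\in L^1(\mathbb R^d)\cap\mathcal C_b(\mathbb R^d)$. Then any classical solution $u$ of the problem $$\begin{cases}u_t=\nabla\cdot\bigl((\varepsilon+u_+)^\alpha\nabla v\bigr)+\varepsilon\Delta u&\text{in }(0,+\infty)\times\mathbb R^d,\\ -\Delta v=u&\text{in }(0,+\infty)\times\mathbb R^d,\\ u(t,x)\to0&\text{as }|x|\to+\infty,\ t>0,\\ u=u_0&\text{at }t=0,\end{cases}$$ where $v=\mathrm N(u)$ is the Newtonian potential of $u(t,\cdot)$, satisfies, for every $1\le p\le\infty$ and $t\ge0$, $$\|u(t,\cdot)_+\|_{L^p(\mathbb R^d)}\le\|(u_0)_+\|_{L^p(\mathbb R^d)}.$$ The same holds for the negative part, $\|u(t,\cdot)_-\|_{L^p(\mathbb R^d)}\le\|(u_0)_-\|_{L^p(\mathbb R^d)}$; so if $u_0\ge0$, then $u\ge0$.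
   Context: $u_+=\max(u,0)$, $u_-=\max(-u,0)$; $\mathcal C_b$ denotes bounded continuous functions. $\mathrm N(u)$ is the Newtonian potential (inverse of $-\Delta$ on $\mathbb R^d$); only its gradient enters, and for $u(t,\cdot)\in L^1\cap L^\infty$ it is $\nabla\mathrm N(u)(t,x)=-\dfrac1{d\omega_d}\displaystyle\int_{\mathbb R^d}\frac{x-z}{|x-z|^d}\,u(t,z)\,dz$, with $\omega_d$ the volume of the unit ball of $\mathbb R^d$. A classical solution is a function $u$, continuous on $[0,\infty)\times\mathbb R^d$, bounded on $[0,T]\times\mathbb R^d$ for each $T$, with $u\in\mathcal C([0,\infty);L^1(\mathbb R^d))$, once continuously differentiable in $t$ and twice in $x$ for $t>0$, which satisfies the equation pointwise and takes the initial datum. *)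

theory Defs
  imports "HOL-Analysis.Analysis" "HOL-Probability.Essential_Supremum"
begin

text \<open>Throughout, \<open>\<real>\<^sup>d\<close> is a type of class \<open>euclidean_space\<close> with \<open>d = DIM('a)\<close>.
  The operators below are meaningful only where the total derivatives involved exist;
  every use is accompanied or guarded by the corresponding differentiability condition.\<close>

definition gradient :: "('a::euclidean_space \<Rightarrow> real) \<Rightarrow> 'a \<Rightarrow> 'a" where
  "gradient w x = (\<Sum>b\<in>Basis. frechet_derivative w (at x) b *\<^sub>R b)"

definition divergence :: "('a::euclidean_space \<Rightarrow> 'a) \<Rightarrow> 'a \<Rightarrow> real" where
  "divergence F x = (\<Sum>b\<in>Basis. frechet_derivative F (at x) b \<bullet> b)"

definition laplacian :: "('a::euclidean_space \<Rightarrow> real) \<Rightarrow> 'a \<Rightarrow> real" where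
  "laplacian w x = divergence (gradient w) x"

text \<open>The integrand vanishes at \<open>z = x\<close> by the convention \<open>y / 0 = 0\<close>.\<close>

definition newtonian_gradient :: "('a::euclidean_space \<Rightarrow> real) \<Rightarrow> 'a \<Rightarrow> 'a" where
  "newtonian_gradient f x =
     - (1 / (real DIM('a) * measure lborel (ball (0::'a) 1))) *\<^sub>R
       (\<integral>z. (f z / norm (x - z) ^ DIM('a)) *\<^sub>R (x - z) \<partial>lborel)"

text \<open>The Newtonian potential of an integrable function is only determined up to an additive
  constant for \<open>d \<le> 2\<close> (the integral of the fundamental solution against \<open>f\<close> need not
  converge), so it is characterised by its gradient, which is all that enters the problem.\<close>

definition newtonian_potential ::
  "('a::euclidean_space \<Rightarrow> real) \<Rightarrow> ('a \<Rightarrow> real) \<Rightarrow> bool" where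
  "newtonian_potential f w \<longleftrightarrow>
     (\<forall>x. w differentiable (at x) \<and> gradient w x = newtonian_gradient f x)"

definition flux ::
  "real \<Rightarrow> real \<Rightarrow> ('a::euclidean_space \<Rightarrow> real) \<Rightarrow> ('a \<Rightarrow> real) \<Rightarrow> 'a \<Rightarrow> 'a" where
  "flux \<alpha> \<epsilon> f w = (\<lambda>x. ((\<epsilon> + max (f x) 0) powr \<alpha>) *\<^sub>R gradient w x)"

text \<open>\<open>u\<close> is in \<open>C([0,\<infinity>); L\<^sup>1)\<close>.\<close>

definition continuous_into_L1 :: "(real \<Rightarrow> 'a::euclidean_space \<Rightarrow> real) \<Rightarrow> bool" where
  "continuous_into_L1 u \<longleftrightarrow>
     (\<forall>t\<ge>0. integrable lborel (u t)) \<and>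
     (\<forall>s\<ge>0. ((\<lambda>t. \<integral>x. \<bar>u t x - u s x\<bar> \<partial>lborel) \<longlongrightarrow> 0) (at s within {0..}))"

text \<open>\<open>u\<close> is once continuously differentiable in \<open>t\<close> and twice in \<open>x\<close> on \<open>t > 0\<close>, with
  derivatives continuous jointly in \<open>(t,x)\<close>. The second derivative in \<open>x\<close> is the derivative of
  the gradient, applied to an arbitrary direction \<open>h\<close>.\<close>

definition C12 :: "(real \<Rightarrow> 'a::euclidean_space \<Rightarrow> real) \<Rightarrow> bool" where
  "C12 u \<longleftrightarrow>
     (\<forall>t>0. \<forall>x. (\<lambda>s. u s x) differentiable (at t)) \<and>
     (\<forall>t>0. \<forall>x. u t differentiable (at x)) \<and>
     (\<forall>t>0. \<forall>x. gradient (u t) differentiable (at x)) \<and>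
     continuous_on ({0<..} \<times> UNIV) (\<lambda>(t, x). deriv (\<lambda>s. u s x) t) \<and>
     continuous_on ({0<..} \<times> UNIV) (\<lambda>(t, x). gradient (u t) x) \<and>
     (\<forall>h. continuous_on ({0<..} \<times> UNIV)
            (\<lambda>(t, x). frechet_derivative (gradient (u t)) (at x) h))"

text \<open>Since \<open>s \<mapsto> (\<epsilon> + max s 0) powr \<alpha>\<close> has a corner at \<open>s = 0\<close>, the flux of a \<open>C\<^sup>2\<close> function need
  not be differentiable at a zero of \<open>u\<close>, and there its divergence has no pointwise meaning. The
  evolution equation is therefore required at exactly those points where the flux is
  differentiable; these include all points with \<open>u t x \<noteq> 0\<close>. This covers both the solutions
  whose flux is differentiable everywhere and those for which the divergence is expanded with
  the convention that the gradient of \<open>max u 0\<close> vanishes where \<open>u = 0\<close>.\<close>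

definition classical_solution ::
  "real \<Rightarrow> real \<Rightarrow> ('a::euclidean_space \<Rightarrow> real) \<Rightarrow>
   (real \<Rightarrow> 'a \<Rightarrow> real) \<Rightarrow> (real \<Rightarrow> 'a \<Rightarrow> real) \<Rightarrow> bool" where
  "classical_solution \<alpha> \<epsilon> u0 u v \<longleftrightarrow>
     continuous_on ({0..} \<times> UNIV) (\<lambda>(t, x). u t x) \<and>
     (\<forall>T. bounded ((\<lambda>(t, x). u t x) ` ({0..T} \<times> UNIV))) \<and>
     continuous_into_L1 u \<and>
     C12 u \<and>
     (\<forall>t>0. newtonian_potential (u t) (v t)) \<and>
     (\<forall>t>0. \<forall>x. flux \<alpha> \<epsilon> (u t) (v t) differentiable (at x) \<longrightarrow>
        deriv (\<lambda>s. u s x) t = divergence (flux \<alpha> \<epsilon> (u t) (v t)) x + \<epsilon> * laplacian (u t) x) \<and>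
     (\<forall>t>0. \<forall>x. gradient (v t) differentiable (at x) \<and> - laplacian (v t) x = u t x) \<and>
     (\<forall>t>0. (u t \<longlongrightarrow> 0) at_infinity) \<and>
     (\<forall>x. u 0 x = u0 x)"

text \<open>The \<open>L\<^sup>p\<close> norm with respect to Lebesgue measure, with values in \<open>[0,\<infinity>]\<close>.\<close>

definition Lp_norm :: "ennreal \<Rightarrow> ('a::euclidean_space \<Rightarrow> real) \<Rightarrow> ennreal" where
  "Lp_norm p f =
     (if p = \<infinity> then esssup lborel (\<lambda>x. ennreal \<bar>f x\<bar>)
      else let I = \<integral>\<^sup>+ x. ennreal (\<bar>f x\<bar> powr enn2real p) \<partial>lborel
           in if I = \<infinity> then \<infinity> else ennreal (enn2real I powr (1 / enn2real p)))"

end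

theory Submission
  imports Defs
begin

text \<open>Fix a \<open>C\<^sup>2\<close> convex \<open>\<phi>\<close> vanishing on \<open>(-\<infinity>, 0]\<close>, write \<open>f(s) = (\<epsilon> + s\<^sub>+)\<^sup>\<alpha>\<close>, and let \<open>P' = \<phi>' f'\<close>,
  \<open>P(0) = 0\<close>. Multiplying the equation by \<open>\<phi>'(u)\<close> turns the drift term into
  \<open>\<nabla>P(u) \<cdot> \<nabla>v - \<phi>'(u) f(u) u\<close>; as \<open>-\<Delta>v = u\<close>, its integral is that of \<open>(P(u) - \<phi>'(u) f(u)) u\<close>, which is
  nonpositive because \<open>\<phi>' f - P\<close> has derivative \<open>\<phi>'' f \<ge> 0\<close>. The diffusion term contributes
  \<open>-\<epsilon> \<phi>''(u) |\<nabla>u|\<^sup>2\<close>, so \<open>\<integral>\<phi>(u)\<close> does not increase. To justify this, one inserts a cutoff at radius \<open>R\<close>; the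
  error is \<open>O(1/R)\<close> since \<open>\<nabla>v\<close> is bounded and \<open>u(t) \<in> L\<^sup>1\<close>. Only points with \<open>u > 0\<close> matter, so the corner
  of \<open>f\<close> is harmless. For \<open>-u\<close> the same argument applies with the constant \<open>f = \<epsilon>\<^sup>\<alpha>\<close>. The \<open>L\<^sup>p\<close> bounds
  follow with smooth convex approximations of \<open>s\<^sub>+\<^sup>p\<close>, and for \<open>p = \<infinity>\<close> with \<open>\<phi>(s) = (s - M)\<^sub>+\<^sup>3\<close>.\<close>

section \<open>Integrals of directional derivatives\<close>

text \<open>The obstacle is the drift term. \<open>gradient (v t)\<close> is only assumed
  differentiable at each point, with no continuity of its derivative, so the classical divergence
  theorem cannot be applied to it. The equation is expanded pointwise, and the integral of grad P(u)
  . grad v, with the cutoff, is evaluated through the weak form of the Poisson equation, which is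
  derived from the explicit kernel. This needs the cutoff times P(u) to be C^1. Hence P is built
  from a continuous extension of f' from s > 0 to the whole line; since \<phi>' vanishes on s \<le>
  0, any such extension serves. The kernel is regularised by a truncation that is Lipschitz but not
  C^1, so integration by parts has to tolerate derivatives that exist only almost everywhere. In
  time, u is differentiable only for t > 0. The initial datum is reached because the localised
  functional is continuous on [0,T] and the mean value theorem needs derivatives only inside; R
  tends to infinity afterwards. The bound |\<phi>(s)| \<le> c |s| on the bounded range of u makes
  \<phi>(u(t)) integrable.\<close>

lemma lborel_integral_translation:
  fixes f :: "'a::euclidean_space \<Rightarrow> 'b::{banach, second_countable_topology}"
  assumes "f \<in> borel_measurable borel"
  shows "(\<integral>x. f (x + c) \<partial>lborel) = (\<integral>x. f x \<partial>lborel)"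
proof -
  have "(\<integral>x. f x \<partial>lborel) = (\<integral>x. f x \<partial>distr lborel borel ((+) c))"
    by (simp add: lborel_distr_plus)
  also have "\<dots> = (\<integral>x. f (c + x) \<partial>lborel)"
    using assms by (subst integral_distr) auto
  finally show ?thesis by (simp add: add.commute)
qed

lemma lborel_integrable_translation:
  fixes f :: "'a::euclidean_space \<Rightarrow> 'b::{banach, second_countable_topology}"
  assumes "integrable lborel f"
  shows "integrable lborel (\<lambda>x. f (x + c))"
proof -
  have "integrable (distr lborel borel ((+) c)) f"
    using assms by (simp add: lborel_distr_plus)
  then have "integrable lborel (\<lambda>x. f (c + x))"
    using assms by (subst (asm) integrable_distr_eq) auto
  then show ?thesis by (simp add: add.commute)
qed

lemma integrable_continuous_compact_support:
  fixes f :: "'a::euclidean_space \<Rightarrow> real"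
  assumes "continuous_on UNIV f" and "\<And>x. norm x > R \<Longrightarrow> f x = 0"
  shows "integrable lborel f"
proof -
  have "integrable lborel (\<lambda>x. indicator (cball 0 R) x *\<^sub>R f x)"
    using assms(1) by (intro borel_integrable_compact) (auto intro: continuous_on_subset)
  also have "(\<lambda>x. indicator (cball 0 R) x *\<^sub>R f x) = f"
    using assms(2) by (auto simp: fun_eq_iff indicator_def)
  finally show ?thesis .
qed

text \<open>Every difference quotient has integral 0 by translation invariance, and the Lipschitz
  bound with the compact support dominates all of them, so the integral of the limit is 0. An almost
  everywhere derivative suffices, which admits functions with a kink along a sphere.\<close>

lemma integral_directional_derivative_eq_0:
  fixes F D :: "'a::euclidean_space \<Rightarrow> real"
  assumes F: "continuous_on UNIV F"
    and lip: "\<And>x h. \<bar>F (x + h *\<^sub>R b) - F x\<bar> \<le> L * \<bar>h\<bar>"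
    and supp: "\<And>x. norm x > R \<Longrightarrow> F x = 0"
    and D[measurable]: "D \<in> borel_measurable borel"
    and deriv: "AE x in lborel. ((\<lambda>h. (F (x + h *\<^sub>R b) - F x) / h) \<longlongrightarrow> D x) (at 0)"
  shows "integrable lborel D" and "(\<integral>x. D x \<partial>lborel) = 0"
proof -
  define h where "h n = inverse (real (Suc n))" for n
  have h: "h n > 0" "h n \<le> 1" for n by (auto simp: h_def field_simps)
  have hlim: "filterlim h (at 0) sequentially"
    using LIMSEQ_inverse_real_of_nat h(1) by (auto simp: filterlim_at h_def[abs_def] less_imp_neq[symmetric])
  \<comment> \<open>The steps \<open>h n\<close> are at most 1, so a quotient can be nonzero only
    within distance \<open>norm b\<close> of the ball of radius \<open>R\<close>. No sign of
    \<open>L\<close> or \<open>R\<close> is assumed, hence the absolute values.\<close>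
  define w where "w x = \<bar>L\<bar> * indicator (cball (0::'a) (\<bar>R\<bar> + norm b)) x" for x
  define q where "q n x = (F (x + h n *\<^sub>R b) - F x) / h n" for n x
  have Fm[measurable]: "F \<in> borel_measurable borel"
    using F by (rule borel_measurable_continuous_onI)
  have Fi: "integrable lborel F"
    using F supp by (rule integrable_continuous_compact_support)
  have qm: "q n \<in> borel_measurable lborel" for n unfolding q_def by measurable
  have wi: "integrable lborel w"
    unfolding w_def using emeasure_lborel_cball_finite[of "0::'a" "\<bar>R\<bar> + norm b"]
    by (intro integrable_mult_right integrable_real_indicator) (auto simp: less_top)
  have qw: "norm (q n x) \<le> w x" for n x
  proof (cases "x \<in> cball 0 (\<bar>R\<bar> + norm b)")
    case True
    have "\<bar>F (x + h n *\<^sub>R b) - F x\<bar> / h n \<le> L"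
      using lip[of x "h n"] h[of n] by (simp add: field_simps)
    then show ?thesis using True h[of n] by (auto simp: w_def q_def)
  next
    case False
    then have x: "norm x > \<bar>R\<bar> + norm b" by simp
    have "norm x \<le> norm (x + h n *\<^sub>R b) + norm (h n *\<^sub>R b)"
      by (metis add_diff_cancel_right' norm_triangle_ineq4)
    moreover have "norm (h n *\<^sub>R b) \<le> norm b"
      using h[of n] by (auto intro: mult_left_le_one_le)
    ultimately have "norm (x + h n *\<^sub>R b) > R" using x by linarith
    moreover have "norm x > R" using x norm_ge_zero[of b] by linarith
    ultimately show ?thesis using False by (simp add: q_def w_def supp)
  qed
  have lim: "AE x in lborel. (\<lambda>n. q n x) \<longlonglongrightarrow> D x"
    using deriv
  proof eventually_elim
    case (elim x)
    show ?case unfolding q_def using filterlim_compose[OF elim hlim] .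
  qed
  show "integrable lborel D"
    by (rule integrable_dominated_convergence[OF _ qm wi lim]) (use qw in auto)
  have "(\<lambda>n. \<integral>x. q n x \<partial>lborel) \<longlonglongrightarrow> (\<integral>x. D x \<partial>lborel)"
    by (rule integral_dominated_convergence[OF _ qm wi lim]) (use qw in auto)
  moreover have "(\<integral>x. q n x \<partial>lborel) = 0" for n
    unfolding q_def using Fi lborel_integrable_translation[OF Fi]
    by (simp add: lborel_integral_translation[OF Fm])
  ultimately show "(\<integral>x. D x \<partial>lborel) = 0"
    by (simp add: LIMSEQ_const_iff)
qed

lemma continuous_compact_support_bounded:
  fixes f :: "'a::euclidean_space \<Rightarrow> real"
  assumes "continuous_on UNIV f" and "\<And>x. norm x > R \<Longrightarrow> f x = 0"
  obtains B where "B \<ge> 0" and "\<And>x. \<bar>f x\<bar> \<le> B"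
proof -
  have "bounded (f ` cball 0 R)"
    using assms(1) by (intro compact_imp_bounded compact_continuous_image)
      (auto intro: continuous_on_subset)
  then obtain B where B: "\<And>x. x \<in> cball 0 R \<Longrightarrow> \<bar>f x\<bar> \<le> B"
    unfolding bounded_iff by (metis imageI real_norm_def)
  have "\<bar>f x\<bar> \<le> max B 0" for x
    using B[of x] assms(2)[of x] by (cases "norm x \<le> R") (auto simp: le_max_iff_disj)
  then show thesis using that[of "max B 0"] by auto
qed

lemma has_derivative_zero_outside_support:
  assumes "(F has_derivative F') (at x)" and "\<And>x. norm x > R \<Longrightarrow> F x = 0" and "norm x > R"
  shows "F' = (\<lambda>_. 0)"
proof -
  have "((\<lambda>_. 0) has_derivative F') (at x)"
  proof (rule has_derivative_transform_within_open[OF assms(1)])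
    show "open (- cball 0 R)" by auto
  qed (use assms in auto)
  then show ?thesis using has_derivative_unique has_derivative_const by blast
qed

lemma lipschitz_directional_of_C1:
  fixes F :: "'a::euclidean_space \<Rightarrow> real"
  assumes F: "\<And>x. (F has_derivative F' x) (at x)"
    and bd: "\<And>x. \<bar>F' x b\<bar> \<le> L"
  shows "\<bar>F (x + h *\<^sub>R b) - F x\<bar> \<le> L * \<bar>h\<bar>"
proof -
  have d: "((\<lambda>s. F (x + s *\<^sub>R b)) has_real_derivative F' (x + s *\<^sub>R b) b) (at s within UNIV)" for s
  proof -
    have "((\<lambda>s. F (x + s *\<^sub>R b)) has_derivative (\<lambda>t. F' (x + s *\<^sub>R b) (t *\<^sub>R b))) (at s)"
      by (rule has_derivative_compose[OF _ F]) (auto intro!: derivative_eq_intros)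
    moreover have "F' (x + s *\<^sub>R b) (t *\<^sub>R b) = F' (x + s *\<^sub>R b) b * t" for t
      using linear_scale[OF has_derivative_linear[OF F]] by simp
    ultimately show ?thesis by (simp add: has_field_derivative_def)
  qed
  have "norm (F (x + h *\<^sub>R b) - F (x + 0 *\<^sub>R b)) \<le> L * norm (h - 0)"
    by (rule field_differentiable_bound[OF convex_UNIV d]) (use bd in auto)
  then show ?thesis by simp
qed

text \<open>A continuous partial derivative with compact support is bounded, and this bound is the
  Lipschitz constant for the difference quotients. The diffusion terms are integrated by parts in
  this form.\<close>

lemma integral_partial_C1_eq_0:
  fixes F :: "'a::euclidean_space \<Rightarrow> real"
  assumes F: "\<And>x. (F has_derivative F' x) (at x)"
    and cont: "continuous_on UNIV (\<lambda>x. F' x b)"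
    and supp: "\<And>x. norm x > R \<Longrightarrow> F x = 0"
  shows "(\<integral>x. F' x b \<partial>lborel) = 0"
proof -
  have supp': "F' x b = 0" if "norm x > R" for x
    using has_derivative_zero_outside_support[OF F supp that] by simp
  obtain L where L: "\<And>x. \<bar>F' x b\<bar> \<le> L"
    using continuous_compact_support_bounded[OF cont supp'] by blast
  show ?thesis
  proof (rule integral_directional_derivative_eq_0(2)[where F=F and b=b and R=R])
    show "continuous_on UNIV F"
      using F by (meson continuous_at_imp_continuous_on has_derivative_continuous)
    show "AE x in lborel. ((\<lambda>h. (F (x + h *\<^sub>R b) - F x) / h) \<longlongrightarrow> F' x b) (at 0)"
    proof (rule AE_I2)
      fix x
      have "((\<lambda>s. F (x + s *\<^sub>R b)) has_derivative (\<lambda>t. F' (x + 0 *\<^sub>R b) (t *\<^sub>R b))) (at 0)"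
        by (rule has_derivative_compose[OF _ F]) (auto intro!: derivative_eq_intros)
      moreover have "F' x (t *\<^sub>R b) = F' x b * t" for t
        using linear_scale[OF has_derivative_linear[OF F]] by simp
      ultimately have "((\<lambda>s. F (x + s *\<^sub>R b)) has_real_derivative F' x b) (at 0)"
        by (simp add: has_field_derivative_def)
      then show "((\<lambda>h. (F (x + h *\<^sub>R b) - F x) / h) \<longlongrightarrow> F' x b) (at 0)"
        by (simp add: DERIV_def)
    qed
  qed (use lipschitz_directional_of_C1[OF F L] supp cont in \<open>auto intro: borel_measurable_continuous_onI\<close>)
qed

section \<open>The gradient of the Newtonian potential\<close>

text \<open>The index \<open>n\<close> is the predecessor of the least \<open>k\<close> with
  \<open>(1/2) ^ k \<le> r\<close>; the assumption \<open>r < 1\<close> excludes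
  \<open>k = 0\<close>. It selects the dyadic shell containing a given point.\<close>

lemma dyadic_scale:
  assumes "0 < r" and "r < 1"
  obtains n :: nat where "(1/2) ^ Suc n \<le> r" and "r < (1/2::real) ^ n"
proof -
  obtain m where m: "(1/2) ^ m < r"
    using real_arch_pow_inv[OF assms(1), of "1/2"] by auto
  define k where "k = (LEAST k. (1/2) ^ k \<le> r)"
  have k: "(1/2) ^ k \<le> r"
    unfolding k_def using m by (intro LeastI[of "\<lambda>k. (1/2) ^ k \<le> r" m]) simp
  with assms have "k \<noteq> 0" by (intro notI) auto
  then obtain n where n: "k = Suc n" using not0_implies_Suc by blast
  have "\<not> (1/2) ^ n \<le> r"
    using not_less_Least[of n "\<lambda>k. (1/2) ^ k \<le> r"] n unfolding k_def by simp
  then show thesis using that[of n] k n by auto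
qed

text \<open>The quotient form is the exact norm of the Newtonian kernel \<open>y / |y|^d\<close>, so
  the value 0 at the origin agrees with the convention in \<open>newtonian_gradient\<close>, also
  for \<open>d = 1\<close>.\<close>

definition kernel_near :: "'a::euclidean_space \<Rightarrow> real" where
  "kernel_near y = norm y / norm y ^ DIM('a) * indicator (ball 0 1) y"

lemma kernel_near_measurable [measurable]:
  "(kernel_near :: 'a::euclidean_space \<Rightarrow> real) \<in> borel_measurable borel"
proof -
  have [measurable]: "ball (0::'a) 1 \<in> sets borel" by simp
  show ?thesis unfolding kernel_near_def[abs_def] by measurable
qed

lemma kernel_near_nonneg: "kernel_near y \<ge> 0"
  by (simp add: kernel_near_def)

text \<open>Dyadic decomposition: on \<open>2\<^sup>-\<^sup>n\<^sup>-\<^sup>1 \<le> |y| < 2\<^sup>-\<^sup>n\<close> the kernel \<open>|y|\<^sup>1\<^sup>-\<^sup>d\<close> is at most \<open>2\<^bsup>(n+1)(d-1)\<^esup>\<close>, and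
  that shell has measure at most \<open>2\<^bsup>-nd\<^esup> \<omega>\<^sub>d\<close>.\<close>

lemma kernel_near_integrable: "integrable lborel (kernel_near :: 'a::euclidean_space \<Rightarrow> real)"
proof -
  define d where "d = DIM('a)"
  have d: "d = Suc (d - 1)" by (simp add: d_def)
  define \<omega> where "\<omega> = measure lborel (ball (0::'a) 1)"
  define a where "a n = ((2::real) ^ Suc n) ^ (d - 1)" for n
  \<comment> \<open>The terms live on full balls instead of shells. The overlap only enlarges the
    majorant, and a single term already dominates the kernel at a given point.\<close>
  define s where "s n y = ennreal (a n * indicator (ball (0::'a) ((1/2) ^ n)) y)" for n y
  have a0: "a n \<ge> 0" for n by (simp add: a_def)
  have [measurable]: "ball (0::'a) ((1/2) ^ n) \<in> sets borel" for n by simp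
  have sm[measurable]: "s n \<in> borel_measurable borel" for n unfolding s_def by measurable
  have le: "ennreal (norm (kernel_near y)) \<le> (\<Sum>n. s n y)" for y :: 'a
  proof (cases "y \<noteq> 0 \<and> norm y < 1")
    case True
    then obtain n where n: "(1/2) ^ Suc n \<le> norm y" "norm y < (1/2) ^ n"
      using dyadic_scale[of "norm y"] by auto
    have "norm y / norm y ^ d = (1 / norm y) ^ (d - 1)"
      using True by (subst d) (simp add: power_one_over field_simps)
    also have "\<dots> \<le> (2 ^ Suc n) ^ (d - 1)"
    proof (rule power_mono)
      have "1 / norm y \<le> 1 / ((1/2) ^ Suc n)"
        using n True by (intro divide_left_mono) auto
      then show "1 / norm y \<le> 2 ^ Suc n" by (simp add: power_one_over)
    qed simp
    finally have "kernel_near y \<le> a n"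
      using True by (simp add: kernel_near_def a_def d_def)
    then have "ennreal (norm (kernel_near y)) \<le> s n y"
      using n(2) kernel_near_nonneg[of y] by (auto simp: s_def intro!: ennreal_leI)
    also have "\<dots> \<le> (\<Sum>n. s n y)"
      using sum_le_suminf[of "\<lambda>n. s n y" "{n}"] by simp
    finally show ?thesis .
  next
    case False
    then show ?thesis by (auto simp: kernel_near_def)
  qed
  have int_s: "(\<integral>\<^sup>+ y. s n y \<partial>lborel) = ennreal (2 ^ (d - 1) * \<omega> * (1/2) ^ n)" for n
  proof -
    have "(\<integral>\<^sup>+ y. s n y \<partial>lborel) = ennreal (a n) * emeasure lborel (ball (0::'a) ((1/2) ^ n))"
      unfolding s_def by (simp add: ennreal_mult'' a0 nn_integral_cmult_indicator ennreal_indicator)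
    also have "emeasure lborel (ball (0::'a) ((1/2) ^ n)) = ennreal (measure lborel (ball (0::'a) ((1/2) ^ n)))"
      using emeasure_lborel_ball_finite[of "0::'a"] by (intro emeasure_eq_ennreal_measure) (auto simp: less_top)
    also have "measure lborel (ball (0::'a) ((1/2) ^ n)) = ((1/2) ^ n) ^ d * \<omega>"
      using content_ball_conv_unit_ball[of "(1/2) ^ n" "0::'a"] by (simp add: \<omega>_def d_def)
    also have "ennreal (a n) * ennreal (((1/2) ^ n) ^ d * \<omega>) = ennreal (a n * (((1/2) ^ n) ^ d * \<omega>))"
      using a0 by (simp add: ennreal_mult'' \<omega>_def)
    also have "a n * (((1/2) ^ n) ^ d * \<omega>) = 2 ^ (d - 1) * \<omega> * (1/2) ^ n"
    proof -
      have "((1/2::real) ^ n) ^ d = (1/2) ^ n * ((1/2) ^ n) ^ (d - 1)"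
        by (subst d) simp
      moreover have "a n = 2 ^ (d - 1) * (2 ^ n) ^ (d - 1)"
        by (simp add: a_def power_mult_distrib)
      moreover have "(2 ^ n) ^ (d - 1) * ((1/2::real) ^ n) ^ (d - 1) = 1"
        by (simp add: power_mult_distrib[symmetric])
      ultimately show ?thesis by (simp add: algebra_simps)
    qed
    finally show ?thesis .
  qed
  have "(\<integral>\<^sup>+ y. ennreal (norm (kernel_near (y::'a))) \<partial>lborel) \<le> (\<integral>\<^sup>+ y. (\<Sum>n. s n y) \<partial>lborel)"
    by (rule nn_integral_mono) (use le in auto)
  also have "\<dots> = (\<Sum>n. \<integral>\<^sup>+ y. s n y \<partial>lborel)"
    by (rule nn_integral_suminf) simp
  also have "\<dots> = (\<Sum>n. ennreal (2 ^ (d - 1) * \<omega> * (1/2) ^ n))"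
    by (simp add: int_s)
  also have "\<dots> < \<infinity>"
  proof -
    have "(\<Sum>n. ennreal (2 ^ (d - 1) * \<omega> * (1/2) ^ n)) \<noteq> top"
      by (rule ennreal_suminf_neq_top) (auto intro!: summable_mult summable_geometric simp: \<omega>_def)
    then show ?thesis by (simp add: less_top)
  qed
  finally show ?thesis by (intro integrableI_bounded) auto
qed

text \<open>Split at \<open>norm (x - z) = 1\<close>: inside, \<open>f\<close> is bounded by
  \<open>M\<close> and the kernel is integrable; outside, the kernel is at most 1 and
  \<open>f\<close> is integrable. The resulting bound is uniform in \<open>x\<close>.\<close>

lemma newtonian_kernel_dominated:
  fixes f :: "'a::euclidean_space \<Rightarrow> real"
  assumes f: "integrable lborel f" and bd: "\<And>x. \<bar>f x\<bar> \<le> M"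
  shows "integrable lborel (\<lambda>z. \<bar>f z\<bar> * (norm (x - z) / norm (x - z) ^ DIM('a)))" (is "integrable _ ?k")
    and "(\<integral>z. \<bar>f z\<bar> * (norm (x - z) / norm (x - z) ^ DIM('a)) \<partial>lborel)
      \<le> M * (\<integral>y. kernel_near (y::'a) \<partial>lborel) + (\<integral>z. \<bar>f z\<bar> \<partial>lborel)"
proof -
  have [measurable]: "f \<in> borel_measurable borel" using f by auto
  \<comment> \<open>The kernel is even, so the reflection \<open>x - z\<close> becomes a
    translation.\<close>
  have kn: "kernel_near (x - z) = kernel_near (z + (- x))" for z :: 'a
    by (simp add: kernel_near_def norm_minus_commute dist_norm indicator_def)
  have ki: "integrable lborel (\<lambda>z. kernel_near (x - z))"
    unfolding kn by (rule lborel_integrable_translation[OF kernel_near_integrable])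
  have kI: "(\<integral>z. kernel_near (x - z) \<partial>lborel) = (\<integral>y. kernel_near (y::'a) \<partial>lborel)"
    unfolding kn by (rule lborel_integral_translation) simp
  have bi: "integrable lborel (\<lambda>z. M * kernel_near (x - z) + \<bar>f z\<bar>)"
    using ki f by auto
  have le: "?k z \<le> M * kernel_near (x - z) + \<bar>f z\<bar>" for z
  proof (cases "norm (x - z) < 1")
    case True
    then have "?k z = \<bar>f z\<bar> * kernel_near (x - z)"
      by (simp add: kernel_near_def)
    also have "\<dots> \<le> M * kernel_near (x - z)"
      using bd kernel_near_nonneg by (intro mult_right_mono) auto
    finally show ?thesis by linarith
  next
    case False
    then have "norm (x - z) ^ 1 \<le> norm (x - z) ^ DIM('a)"
      by (intro power_increasing) (auto simp: Suc_le_eq)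
    moreover have "norm (x - z) ^ DIM('a) > 0" using False by (intro zero_less_power) linarith
    ultimately have "norm (x - z) / norm (x - z) ^ DIM('a) \<le> 1"
      by (simp add: divide_le_eq)
    then have "?k z \<le> \<bar>f z\<bar>" by (intro mult_left_le) auto
    moreover have "M \<ge> 0" using bd[of x] by linarith
    then have "M * kernel_near (x - z) \<ge> 0" using kernel_near_nonneg[of "x - z"] by simp
    ultimately show ?thesis by linarith
  qed
  show i: "integrable lborel ?k"
  proof (rule Bochner_Integration.integrable_bound[OF bi])
    show "AE z in lborel. norm (?k z) \<le> norm (M * kernel_near (x - z) + \<bar>f z\<bar>)"
    proof (rule AE_I2)
      fix z
      have "norm (?k z) = ?k z" by simp
      also note le[of z]
      finally show "norm (?k z) \<le> norm (M * kernel_near (x - z) + \<bar>f z\<bar>)" by simp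
    qed
  qed measurable
  have "(\<integral>z. ?k z \<partial>lborel) \<le> (\<integral>z. M * kernel_near (x - z) + \<bar>f z\<bar> \<partial>lborel)"
    by (rule integral_mono[OF i bi le])
  also have "\<dots> = M * (\<integral>y. kernel_near (y::'a) \<partial>lborel) + (\<integral>z. \<bar>f z\<bar> \<partial>lborel)"
    using ki f by (simp add: kI)
  finally show "(\<integral>z. ?k z \<partial>lborel) \<le> M * (\<integral>y. kernel_near (y::'a) \<partial>lborel) + (\<integral>z. \<bar>f z\<bar> \<partial>lborel)" .
qed

text \<open>This truncation of \<open>y / |y|\<^sup>d\<close> is Lipschitz, and its divergence is exactly \<open>d \<eta>\<^bsup>-d\<^esup>\<close> on the ball of
  radius \<open>\<eta>\<close> and \<open>0\<close> outside; it thus integrates to \<open>d \<omega>\<^sub>d\<close> without polar coordinates.\<close>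

definition trunc_kernel :: "real \<Rightarrow> 'a::euclidean_space \<Rightarrow> 'a" where
  "trunc_kernel \<eta> y = (1 / max (norm y) \<eta> ^ DIM('a)) *\<^sub>R y"

lemma trunc_kernel_measurable [measurable]:
  "(trunc_kernel \<eta> :: 'a::euclidean_space \<Rightarrow> 'a) \<in> borel_measurable borel"
  unfolding trunc_kernel_def[abs_def] by measurable

text \<open>Truncation only shrinks the kernel, so one integrable majorant serves all \<eta> when
  \<eta> tends to 0.\<close>

lemma norm_trunc_kernel_le:
  fixes y :: "'a::euclidean_space"
  assumes "\<eta> > 0"
  shows "norm (trunc_kernel \<eta> y) \<le> norm y / norm y ^ DIM('a)"
proof (cases "y = 0")
  case False
  then have "norm y / max (norm y) \<eta> ^ DIM('a) \<le> norm y / norm y ^ DIM('a)"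
    using assms by (intro divide_left_mono power_mono mult_pos_pos zero_less_power) auto
  then show ?thesis using assms by (simp add: trunc_kernel_def)
qed (simp add: trunc_kernel_def)

text \<open>The norm increases up to \<open>norm y = \<eta>\<close>, where the bound is attained,
  and does not increase beyond. For fixed \<eta> this bounded kernel permits exchanging the order of
  integration.\<close>

lemma norm_trunc_kernel_bound:
  fixes y :: "'a::euclidean_space"
  assumes "\<eta> > 0"
  shows "norm (trunc_kernel \<eta> y) \<le> \<eta> / \<eta> ^ DIM('a)"
proof -
  define r where "r = max (norm y) \<eta>"
  have r: "r \<ge> \<eta>" "r > 0" "norm y \<le> r" using assms by (auto simp: r_def)
  have e: "x / x ^ DIM('a) = 1 / x ^ (DIM('a) - 1)" if "x > 0" for x :: real
    using that by (subst power_eq_if) simp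
  have "norm (trunc_kernel \<eta> y) = norm y / r ^ DIM('a)"
    using r by (simp add: trunc_kernel_def r_def[symmetric])
  also have "\<dots> \<le> r / r ^ DIM('a)"
    using r by (intro divide_right_mono) auto
  also have "\<dots> = 1 / r ^ (DIM('a) - 1)" using e r by simp
  also have "\<dots> \<le> 1 / \<eta> ^ (DIM('a) - 1)"
    using r assms by (intro divide_left_mono power_mono) auto
  finally show ?thesis using e assms by simp
qed

lemma trunc_kernel_tendsto:
  fixes y :: "'a::euclidean_space"
  assumes "e \<longlonglongrightarrow> 0"
  shows "(\<lambda>n. trunc_kernel (e n) y) \<longlonglongrightarrow> (1 / norm y ^ DIM('a)) *\<^sub>R y"
proof (cases "y = 0")
  case False
  then have "eventually (\<lambda>n. e n < norm y) sequentially"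
    using order_tendstoD(2)[OF assms] by simp
  then have "eventually (\<lambda>n. trunc_kernel (e n) y = (1 / norm y ^ DIM('a)) *\<^sub>R y) sequentially"
    by eventually_elim (simp add: trunc_kernel_def max_def)
  then show ?thesis by (simp add: tendsto_eventually)
qed (simp add: trunc_kernel_def)

text \<open>With \<open>a\<close> and \<open>b\<close> the reciprocals of the truncated norms, the
  difference is \<open>b ^ d *\<^sub>R (x - y) + (a ^ d - b ^ d) *\<^sub>R x\<close>. The first part
  contributes the 1 in the constant. In the second, \<open>a ^ d - b ^ d\<close> is
  \<open>a - b\<close> times a sum of \<open>d\<close> products, and
  \<open>a - b = (s - r) * a * b\<close> supplies the factor \<open>a\<close> that compensates the
  growth of \<open>norm x\<close>.\<close>

lemma trunc_kernel_lipschitz: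
  fixes x y :: "'a::euclidean_space"
  assumes \<eta>: "\<eta> > 0"
  shows "norm (trunc_kernel \<eta> x - trunc_kernel \<eta> y) \<le> (1 + DIM('a)) / \<eta> ^ DIM('a) * norm (x - y)"
proof -
  define d where "d = DIM('a)"
  have d: "d = Suc (d - 1)" by (simp add: d_def)
  define r s where "r = max (norm x) \<eta>" and "s = max (norm y) \<eta>"
  define a b where "a = 1 / r" and "b = 1 / s"
  have r: "r > 0" "r \<ge> \<eta>" "norm x \<le> r" and s: "s > 0" "s \<ge> \<eta>" using \<eta> by (auto simp: r_def s_def)
  have a: "0 \<le> a" "a \<le> 1 / \<eta>" "norm x * a \<le> 1" and b: "0 \<le> b" "b \<le> 1 / \<eta>"
    using r s \<eta> by (auto simp: a_def b_def intro!: divide_left_mono)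
  have rs: "\<bar>s - r\<bar> \<le> norm (x - y)"
    using norm_triangle_ineq3[of x y] by (auto simp: r_def s_def)
  have "trunc_kernel \<eta> x - trunc_kernel \<eta> y = b ^ d *\<^sub>R (x - y) + (a ^ d - b ^ d) *\<^sub>R x"
    by (simp add: trunc_kernel_def a_def b_def r_def s_def d_def power_one_over algebra_simps)
  then have "norm (trunc_kernel \<eta> x - trunc_kernel \<eta> y)
      \<le> b ^ d * norm (x - y) + \<bar>a ^ d - b ^ d\<bar> * norm x"
    using norm_triangle_ineq[of "b ^ d *\<^sub>R (x - y)" "(a ^ d - b ^ d) *\<^sub>R x"] b by simp
  moreover have "b ^ d * norm (x - y) \<le> (1 / \<eta>) ^ d * norm (x - y)"
    using b by (intro mult_right_mono power_mono) auto
  moreover have "\<bar>a ^ d - b ^ d\<bar> * norm x \<le> d * (1 / \<eta>) ^ d * norm (x - y)"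
  proof -
    define S where "S = (\<Sum>p<d. a ^ p * b ^ (d - 1 - p))"
    have S0: "S \<ge> 0" using a b by (auto simp: S_def intro!: sum_nonneg)
    have "S \<le> (\<Sum>p<d. (1 / \<eta>) ^ (d - 1))"
      unfolding S_def
    proof (rule sum_mono)
      fix p assume "p \<in> {..<d}"
      then have "(1 / \<eta>) ^ (d - 1) = (1 / \<eta>) ^ p * (1 / \<eta>) ^ (d - 1 - p)"
        by (simp add: power_add[symmetric])
      then show "a ^ p * b ^ (d - 1 - p) \<le> (1 / \<eta>) ^ (d - 1)"
        using a b \<eta> by (auto intro!: mult_mono power_mono)
    qed
    then have S: "S \<le> d * (1 / \<eta>) ^ (d - 1)" by simp
    have "a ^ d - b ^ d = (a - b) * S"
      unfolding S_def using power_diff_sumr2[of a d b] by (simp add: mult.commute)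
    moreover have "a - b = (s - r) * a * b" using r s by (simp add: a_def b_def field_simps)
    ultimately have "\<bar>a ^ d - b ^ d\<bar> * norm x = \<bar>s - r\<bar> * (norm x * a) * b * S"
      using a b S0 by (simp add: abs_mult mult_ac)
    also have "\<dots> \<le> norm (x - y) * 1 * (1 / \<eta>) * (d * (1 / \<eta>) ^ (d - 1))"
      using rs a b S S0 \<eta> by (intro mult_mono) auto
    also have "\<dots> = d * (1 / \<eta>) ^ d * norm (x - y)"
      by (subst (4) d) (simp add: field_simps)
    finally show ?thesis .
  qed
  ultimately show ?thesis by (simp add: d_def power_one_over algebra_simps add_divide_distrib)
qed

lemma has_derivative_directional_quotient:
  fixes F :: "'a::real_normed_vector \<Rightarrow> real"
  assumes "(F has_derivative F') (at x)"
  shows "((\<lambda>h. (F (x + h *\<^sub>R b) - F x) / h) \<longlongrightarrow> F' b) (at 0)"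
proof -
  have "((\<lambda>s. F (x + s *\<^sub>R b)) has_derivative (\<lambda>t. F' (t *\<^sub>R b))) (at 0)"
    by (rule has_derivative_compose) (use assms in \<open>auto intro!: derivative_eq_intros\<close>)
  moreover have "F' (t *\<^sub>R b) = F' b * t" for t
    using linear_scale[OF has_derivative_linear[OF assms]] by simp
  ultimately have "((\<lambda>s. F (x + s *\<^sub>R b)) has_real_derivative F' b) (at 0)"
    by (simp add: has_field_derivative_def)
  then show ?thesis by (simp add: DERIV_def)
qed

text \<open>The kernel is linear inside the sphere of radius \<eta> and equals
  \<open>y / |y|^d\<close> outside. Its derivative jumps across the sphere, which is a null set and
  is left out.\<close>

lemma trunc_kernel_inner_has_derivative:
  fixes x :: "'a::euclidean_space"
  assumes "norm x \<noteq> \<eta>" and "\<eta> > 0"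
  shows "((\<lambda>y. trunc_kernel \<eta> y \<bullet> b) has_derivative
    (\<lambda>h. if norm x < \<eta> then (h \<bullet> b) / \<eta> ^ DIM('a)
         else (h \<bullet> b) / norm x ^ DIM('a) - DIM('a) * (x \<bullet> b) * (x \<bullet> h) / norm x ^ (DIM('a) + 2))) (at x)"
proof (cases "norm x < \<eta>")
  case True
  have "((\<lambda>y. (y \<bullet> b) / \<eta> ^ DIM('a)) has_derivative (\<lambda>h. (h \<bullet> b) / \<eta> ^ DIM('a))) (at x)"
    using assms by (auto intro!: derivative_eq_intros)
  then have "((\<lambda>y. trunc_kernel \<eta> y \<bullet> b) has_derivative (\<lambda>h. (h \<bullet> b) / \<eta> ^ DIM('a))) (at x)"
    by (rule has_derivative_transform_within_open[OF _ open_ball[of 0 \<eta>]])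
      (use True in \<open>auto simp: trunc_kernel_def max_def\<close>)
  then show ?thesis using True by simp
next
  case False
  then have x: "norm x > \<eta>" "norm x > 0" "x \<noteq> 0" using assms by auto
  define d where "d = DIM('a)"
  have d: "d = Suc (d - 1)" by (simp add: d_def)
  obtain m where m: "d = Suc m" using d by blast
  have eq: "(h \<bullet> b) / norm x ^ d + (x \<bullet> b) * (- (d * norm x ^ (d - 1) * ((x \<bullet> h) / norm x)) / (norm x ^ d)\<^sup>2)
      = (h \<bullet> b) / norm x ^ d - d * (x \<bullet> b) * (x \<bullet> h) / norm x ^ (d + 2)" for h
  proof -
    have "q ^ m / (q * (q ^ Suc m)\<^sup>2) = 1 / q ^ (Suc m + 2)" if "q > 0" for q :: real
      using that by (simp add: field_simps power2_eq_square)
    then have *: "norm x ^ (d - 1) / (norm x * (norm x ^ d)\<^sup>2) = 1 / norm x ^ (d + 2)"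
      using x(2) by (simp add: m)
    have "(x \<bullet> b) * (- (d * norm x ^ (d - 1) * ((x \<bullet> h) / norm x)) / (norm x ^ d)\<^sup>2)
      = - (d * (x \<bullet> b) * (x \<bullet> h)) * (norm x ^ (d - 1) / (norm x * (norm x ^ d)\<^sup>2))"
      by simp
    then show ?thesis unfolding * by simp
  qed
  have n: "(norm has_derivative (\<lambda>h. (x \<bullet> h) / norm x)) (at x)"
    using has_derivative_norm[OF x(3)] by (simp add: sgn_div_norm inner_commute divide_inverse mult.commute)
  have "((\<lambda>y. (y \<bullet> b) * (1 / norm y ^ d)) has_derivative
      (\<lambda>h. (h \<bullet> b) / norm x ^ d + (x \<bullet> b) * (- (d * norm x ^ (d - 1) * ((x \<bullet> h) / norm x)) / (norm x ^ d)\<^sup>2))) (at x)"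
    using x by (auto intro!: derivative_eq_intros n simp: power2_eq_square divide_inverse)
  then have "((\<lambda>y. (y \<bullet> b) * (1 / norm y ^ d)) has_derivative
      (\<lambda>h. (h \<bullet> b) / norm x ^ d - d * (x \<bullet> b) * (x \<bullet> h) / norm x ^ (d + 2))) (at x)"
    unfolding eq .
  then have "((\<lambda>y. trunc_kernel \<eta> y \<bullet> b) has_derivative
      (\<lambda>h. (h \<bullet> b) / norm x ^ d - d * (x \<bullet> b) * (x \<bullet> h) / norm x ^ (d + 2))) (at x)"
    by (rule has_derivative_transform_within_open[OF _ open_Compl[OF closed_cball[of 0 \<eta>]]])
      (use x in \<open>auto simp: trunc_kernel_def max_def d_def\<close>)
  then show ?thesis using x by (simp add: d_def)
qed

lemma has_derivative_inner_lipschitz: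
  fixes \<psi> :: "'a::euclidean_space \<Rightarrow> real"
  assumes "\<And>x. (\<psi> has_derivative (\<lambda>h. g x \<bullet> h)) (at x)" and "\<And>x. norm (g x) \<le> B"
  shows "\<bar>\<psi> (x + y) - \<psi> x\<bar> \<le> B * norm y"
proof -
  have "\<bar>g z \<bullet> y\<bar> \<le> B * norm y" for z
    by (rule order_trans[OF Cauchy_Schwarz_ineq2]) (intro mult_right_mono assms norm_ge_zero)
  then show ?thesis
    using lipschitz_directional_of_C1[OF assms(1), of y "B * norm y" x 1] by simp
qed

text \<open>The divergence of \<psi> times the truncated kernel integrates to 0, coordinate by
  coordinate, so the derivative can be moved from \<psi> to the kernel. The divergence of the latter
  is supported in the small ball.\<close>

lemma integral_trunc_kernel_inner_gradient:
  fixes \<psi> :: "'a::euclidean_space \<Rightarrow> real" and g :: "'a \<Rightarrow> 'a"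
  assumes \<psi>: "\<And>x. (\<psi> has_derivative (\<lambda>h. g x \<bullet> h)) (at x)"
    and g: "continuous_on UNIV g"
    and supp: "\<And>x. norm x > R \<Longrightarrow> \<psi> x = 0"
    and \<eta>: "\<eta> > 0"
  shows "(\<integral>x. trunc_kernel \<eta> x \<bullet> g x \<partial>lborel)
    = - (DIM('a) / \<eta> ^ DIM('a)) * (\<integral>x. \<psi> x * indicator (ball 0 \<eta>) x \<partial>lborel)"
proof -
  define d where "d = DIM('a)"
  define K where "K = (trunc_kernel \<eta> :: 'a \<Rightarrow> 'a)"
  define C where "C = (1 + d) / \<eta> ^ d"
  define P where "P = \<eta> / \<eta> ^ d"
  have C0: "C \<ge> 0" and P0: "P \<ge> 0" using \<eta> by (auto simp: C_def P_def)
  have Kl: "norm (K x - K y) \<le> C * norm (x - y)" for x y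
    using trunc_kernel_lipschitz[OF \<eta>, of x y] by (simp add: K_def C_def d_def)
  have Kb: "norm (K x) \<le> P" for x
    using norm_trunc_kernel_bound[OF \<eta>, of x] by (simp add: K_def P_def d_def)
  have Kc: "continuous_on UNIV K"
    unfolding K_def trunc_kernel_def[abs_def] using \<eta>
    by (intro continuous_intros) (auto simp: max_def)
  have \<psi>c: "continuous_on UNIV \<psi>"
    using \<psi> by (meson continuous_at_imp_continuous_on has_derivative_continuous)
  have [measurable]: "\<psi> \<in> borel_measurable borel" "g \<in> borel_measurable borel" "K \<in> borel_measurable borel"
    using \<psi>c g Kc by (auto intro: borel_measurable_continuous_onI)
  have [measurable]: "ball (0::'a) \<eta> \<in> sets borel" by simp
  have gs: "g x = 0" if "norm x > R" for x
    using has_derivative_zero_outside_support[OF \<psi> supp that] by (metis inner_eq_zero_iff)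
  obtain B where B: "norm (g x) \<le> B" for x
    using continuous_compact_support_bounded[OF continuous_on_norm[OF g], of R] gs
    by (metis abs_norm_cancel norm_zero)
  obtain A where A: "\<bar>\<psi> x\<bar> \<le> A" for x
    using continuous_compact_support_bounded[OF \<psi>c supp] by blast
  \<comment> \<open>\<open>Q b\<close> is the diagonal entry of the derivative of the kernel in
    direction \<open>b\<close>. The branch chosen on the sphere itself is immaterial.\<close>
  define Q where "Q b x = (if norm x < \<eta> then 1 / \<eta> ^ d
      else 1 / norm x ^ d - d * (x \<bullet> b)\<^sup>2 / norm x ^ (d + 2))" for b x :: 'a
  define D where "D b x = Q b x * \<psi> x + (K x \<bullet> b) * (g x \<bullet> b)" for b x
  have Dm[measurable]: "D b \<in> borel_measurable borel" for b
    unfolding D_def Q_def by measurable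
  have D: "integrable lborel (D b)" "(\<integral>x. D b x \<partial>lborel) = 0" if b: "b \<in> Basis" for b
  proof -
    define F where "F x = (K x \<bullet> b) * \<psi> x" for x
    have F1: "continuous_on UNIV F" unfolding F_def using Kc \<psi>c by (intro continuous_intros)
    have F2: "F x = 0" if "norm x > R" for x using supp[OF that] by (simp add: F_def)
    have F3: "\<bar>F (x + h *\<^sub>R b) - F x\<bar> \<le> (C * A + P * B) * \<bar>h\<bar>" for x h
    proof -
      have "F (x + h *\<^sub>R b) - F x = ((K (x + h *\<^sub>R b) - K x) \<bullet> b) * \<psi> (x + h *\<^sub>R b)
          + (K x \<bullet> b) * (\<psi> (x + h *\<^sub>R b) - \<psi> x)"
        by (simp add: F_def algebra_simps)
      then have "\<bar>F (x + h *\<^sub>R b) - F x\<bar> \<le> \<bar>(K (x + h *\<^sub>R b) - K x) \<bullet> b\<bar> * \<bar>\<psi> (x + h *\<^sub>R b)\<bar>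
          + \<bar>K x \<bullet> b\<bar> * \<bar>\<psi> (x + h *\<^sub>R b) - \<psi> x\<bar>"
        by (metis abs_mult abs_triangle_ineq)
      also have "\<dots> \<le> (C * \<bar>h\<bar>) * A + P * (B * \<bar>h\<bar>)"
      proof (intro add_mono mult_mono)
        show "\<bar>(K (x + h *\<^sub>R b) - K x) \<bullet> b\<bar> \<le> C * \<bar>h\<bar>"
          using Basis_le_norm[OF b, of "K (x + h *\<^sub>R b) - K x"] Kl[of "x + h *\<^sub>R b" x] b by simp
        show "\<bar>K x \<bullet> b\<bar> \<le> P" using Basis_le_norm[OF b, of "K x"] Kb[of x] by linarith
        show "\<bar>\<psi> (x + h *\<^sub>R b) - \<psi> x\<bar> \<le> B * \<bar>h\<bar>"
          using has_derivative_inner_lipschitz[OF \<psi> B, of x "h *\<^sub>R b"] b by simp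
      qed (use A C0 P0 in auto)
      finally show ?thesis by (simp add: algebra_simps)
    qed
    have "AE x in lborel. x \<notin> sphere (0::'a) \<eta>"
    proof (rule AE_not_in)
      show "sphere (0::'a) \<eta> \<in> null_sets lborel"
        using negligible_sphere[of "0::'a" \<eta>]
        by (metis borel_closed closed_sphere negligible_iff_null_sets null_sets_completion_iff sets_lborel)
    qed
    then have F4: "AE x in lborel. ((\<lambda>h. (F (x + h *\<^sub>R b) - F x) / h) \<longlongrightarrow> D b x) (at 0)"
    proof eventually_elim
      case (elim x)
      then have nx: "norm x \<noteq> \<eta>" by simp
      show ?case
        using has_derivative_directional_quotient[OF
            has_derivative_mult[OF trunc_kernel_inner_has_derivative[OF nx \<eta>, of b] \<psi>], of b] b
        by (simp add: F_def D_def Q_def K_def d_def power2_eq_square algebra_simps split: if_splits)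
    qed
    show "integrable lborel (D b)" "(\<integral>x. D b x \<partial>lborel) = 0"
      using integral_directional_derivative_eq_0[OF F1 F3 F2 Dm F4] by auto
  qed
  \<comment> \<open>Taking the trace: outside the ball the two parts cancel, because the squared
    coordinates add up to \<open>(norm x)\<^sup>2\<close>.\<close>
  have Qs: "(\<Sum>b\<in>Basis. Q b x) = (d / \<eta> ^ d) * indicator (ball 0 \<eta>) x" for x :: 'a
  proof (cases "norm x < \<eta>")
    case True
    then show ?thesis by (simp add: Q_def d_def)
  next
    case False
    then have x: "norm x > 0" using \<eta> by linarith
    have "(\<Sum>b\<in>Basis. (x \<bullet> b)\<^sup>2) = (norm x)\<^sup>2"
      unfolding power2_norm_eq_inner by (subst euclidean_inner[of x x]) (simp add: power2_eq_square)
    then have "(\<Sum>b\<in>Basis. d * (x \<bullet> b)\<^sup>2 / norm x ^ (d + 2)) = d * (norm x)\<^sup>2 / norm x ^ (d + 2)"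
      by (simp add: sum_divide_distrib[symmetric] sum_distrib_left[symmetric])
    also have "\<dots> = d / norm x ^ d" using x by (simp add: power_add field_simps power2_eq_square)
    finally show ?thesis using False by (simp add: Q_def sum_subtractf d_def)
  qed
  have Ds: "(\<Sum>b\<in>Basis. D b x) = (d / \<eta> ^ d) * (\<psi> x * indicator (ball 0 \<eta>) x) + K x \<bullet> g x" for x
    by (simp add: D_def sum.distrib sum_distrib_right[symmetric] Qs euclidean_inner[of "K x" "g x"])
  have i1: "integrable lborel (\<lambda>x. \<psi> x * indicator (ball 0 \<eta>) x)"
    using integrable_mult_indicator[of "ball 0 \<eta>" lborel \<psi>] integrable_continuous_compact_support[OF \<psi>c supp]
    by (simp add: mult.commute)
  have "integrable lborel (\<lambda>x. (\<Sum>b\<in>Basis. D b x))" using D by auto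
  then have i2: "integrable lborel (\<lambda>x. (\<Sum>b\<in>Basis. D b x) - (d / \<eta> ^ d) * (\<psi> x * indicator (ball 0 \<eta>) x))"
    using i1 by auto
  have "(\<integral>x. (\<Sum>b\<in>Basis. D b x) \<partial>lborel) = (\<Sum>b\<in>Basis. \<integral>x. D b x \<partial>lborel)"
    using D by (intro Bochner_Integration.integral_sum) auto
  also have "\<dots> = 0" using D by simp
  finally have "(\<integral>x. (d / \<eta> ^ d) * (\<psi> x * indicator (ball 0 \<eta>) x) + K x \<bullet> g x \<partial>lborel) = 0"
    by (simp add: Ds)
  moreover have "integrable lborel (\<lambda>x. K x \<bullet> g x)" using i2 by (simp add: Ds)
  ultimately show ?thesis using i1 by (simp add: K_def d_def)
qed

text \<open>The surface area of the unit sphere, that is, the normalising constant of the Newtonian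
  gradient. The argument merely carries the dimension.\<close>

definition ball_factor :: "'a::euclidean_space itself \<Rightarrow> real" where
  "ball_factor _ = DIM('a) * measure lborel (ball (0::'a) 1)"

lemma ball_factor_pos: "ball_factor TYPE('a::euclidean_space) > 0"
  by (simp add: ball_factor_def)

lemma newtonian_gradient_measurable:
  fixes f :: "'a::euclidean_space \<Rightarrow> real"
  assumes [measurable]: "f \<in> borel_measurable borel"
  shows "newtonian_gradient f \<in> borel_measurable borel"
proof -
  have "(\<lambda>x. \<integral>z. (f z / norm (x - z) ^ DIM('a)) *\<^sub>R (x - z) \<partial>lborel) \<in> borel_measurable lborel"
    by (rule lborel.borel_measurable_lebesgue_integral) measurable
  then show ?thesis unfolding newtonian_gradient_def[abs_def] by simp
qed

text \<open>The bound is independent of \<open>x\<close>; together with a bound on the L^1 norm it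
  controls the drift part of the cutoff error.\<close>

lemma norm_newtonian_gradient_le:
  fixes f :: "'a::euclidean_space \<Rightarrow> real"
  assumes f: "integrable lborel f" and bd: "\<And>x. \<bar>f x\<bar> \<le> M"
  shows "norm (newtonian_gradient f x) \<le>
    (M * (\<integral>y. kernel_near (y::'a) \<partial>lborel) + (\<integral>z. \<bar>f z\<bar> \<partial>lborel)) / ball_factor TYPE('a)"
proof -
  have "norm (newtonian_gradient f x) =
      norm (\<integral>z. (f z / norm (x - z) ^ DIM('a)) *\<^sub>R (x - z) \<partial>lborel) / ball_factor TYPE('a)"
    by (simp add: newtonian_gradient_def ball_factor_def)
  also have "\<dots> \<le> (\<integral>z. norm ((f z / norm (x - z) ^ DIM('a)) *\<^sub>R (x - z)) \<partial>lborel) / ball_factor TYPE('a)"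
    using ball_factor_pos[where 'a='a] by (intro divide_right_mono integral_norm_bound) auto
  also have "(\<lambda>z. norm ((f z / norm (x - z) ^ DIM('a)) *\<^sub>R (x - z)))
      = (\<lambda>z. \<bar>f z\<bar> * (norm (x - z) / norm (x - z) ^ DIM('a)))"
    by (simp add: fun_eq_iff)
  also have "(\<integral>z. \<bar>f z\<bar> * (norm (x - z) / norm (x - z) ^ DIM('a)) \<partial>lborel) / ball_factor TYPE('a)
      \<le> (M * (\<integral>y. kernel_near (y::'a) \<partial>lborel) + (\<integral>z. \<bar>f z\<bar> \<partial>lborel)) / ball_factor TYPE('a)"
    using newtonian_kernel_dominated(2)[OF f bd] ball_factor_pos[where 'a='a]
    by (intro divide_right_mono) auto
  finally show ?thesis .
qed

text \<open>Both claims come from the majorant in \<open>newtonian_kernel_dominated\<close>. The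
  second bound is uniform in \<open>n\<close> and \<open>x\<close>, so that a further limit can be
  taken under an integral over \<open>x\<close>. The minus sign undoes the one in
  \<open>newtonian_gradient\<close>.\<close>

lemma trunc_convolution:
  fixes f :: "'a::euclidean_space \<Rightarrow> real"
  assumes f: "integrable lborel f" and bd: "\<And>x. \<bar>f x\<bar> \<le> M" and e: "e \<longlonglongrightarrow> 0" "\<And>n. e n > 0"
  shows "(\<lambda>n. \<integral>z. f z *\<^sub>R trunc_kernel (e n) (x - z) \<partial>lborel)
      \<longlonglongrightarrow> - ball_factor TYPE('a) *\<^sub>R newtonian_gradient f x" (is ?lim)
    and "norm (\<integral>z. f z *\<^sub>R trunc_kernel (e n) (x - z) \<partial>lborel)
      \<le> M * (\<integral>y. kernel_near (y::'a) \<partial>lborel) + (\<integral>z. \<bar>f z\<bar> \<partial>lborel)" (is ?bound)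
proof -
  have [measurable]: "f \<in> borel_measurable borel" using f by auto
  let ?w = "\<lambda>z. \<bar>f z\<bar> * (norm (x - z) / norm (x - z) ^ DIM('a))"
  note w = newtonian_kernel_dominated[OF f bd, of x]
  have le: "norm (f z *\<^sub>R trunc_kernel (e n) (x - z)) \<le> ?w z" for n z
    using mult_left_mono[OF norm_trunc_kernel_le[OF e(2)[of n], of "x - z"], of "\<bar>f z\<bar>"] by simp
  have "(\<lambda>n. \<integral>z. f z *\<^sub>R trunc_kernel (e n) (x - z) \<partial>lborel)
      \<longlonglongrightarrow> (\<integral>z. (f z / norm (x - z) ^ DIM('a)) *\<^sub>R (x - z) \<partial>lborel)"
  proof (rule integral_dominated_convergence[where w="?w"])
    show "AE z in lborel. (\<lambda>n. f z *\<^sub>R trunc_kernel (e n) (x - z))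
        \<longlonglongrightarrow> (f z / norm (x - z) ^ DIM('a)) *\<^sub>R (x - z)"
      using tendsto_scaleR[OF tendsto_const trunc_kernel_tendsto[OF e(1)]] by (auto intro!: AE_I2)
  qed (use w le in auto)
  also have "(\<integral>z. (f z / norm (x - z) ^ DIM('a)) *\<^sub>R (x - z) \<partial>lborel)
      = - ball_factor TYPE('a) *\<^sub>R newtonian_gradient f x"
    using ball_factor_pos[where 'a='a] by (simp add: newtonian_gradient_def ball_factor_def)
  finally show ?lim .
  have "norm (\<integral>z. f z *\<^sub>R trunc_kernel (e n) (x - z) \<partial>lborel)
      \<le> (\<integral>z. norm (f z *\<^sub>R trunc_kernel (e n) (x - z)) \<partial>lborel)"
    by (rule integral_norm_bound)
  also have "\<dots> \<le> (\<integral>z. ?w z \<partial>lborel)"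
    by (rule integral_mono[OF _ w(1) le], rule Bochner_Integration.integrable_bound[OF w(1)])
      (use le in \<open>auto simp: abs_mult\<close>)
  also note w(2)
  finally show ?bound .
qed

text \<open>The expression is the constant \<open>ball_factor\<close> times the average of \<psi>
  over a ball of radius \<open>e n\<close> around \<open>z\<close>; by the Lipschitz condition it
  differs from its limit by at most \<open>ball_factor TYPE('a) * L * e n\<close>.\<close>

lemma ball_average_tendsto:
  fixes \<psi> :: "'a::euclidean_space \<Rightarrow> real"
  assumes \<psi>: "continuous_on UNIV \<psi>" and lip: "\<And>x y. \<bar>\<psi> (x + y) - \<psi> x\<bar> \<le> L * norm y"
    and e: "e \<longlonglongrightarrow> 0" "\<And>n. e n > 0" 
  shows "(\<lambda>n. (DIM('a) / e n ^ DIM('a)) * (\<integral>y. \<psi> (y + z) * indicator (ball 0 (e n)) y \<partial>lborel))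
      \<longlonglongrightarrow> ball_factor TYPE('a) * \<psi> z" (is "?A \<longlonglongrightarrow> _")
proof -
  have [measurable]: "\<psi> \<in> borel_measurable borel" using \<psi> by (auto intro: borel_measurable_continuous_onI)
  \<comment> \<open>Testing the Lipschitz condition with a unit vector gives the sign of
    \<open>L\<close>.\<close>
  have L: "L \<ge> 0" using lip[of 0 "SOME b. b \<in> Basis"] norm_Basis[OF SOME_Basis[where 'a='a]] by simp
  have b: "\<bar>?A n - ball_factor TYPE('a) * \<psi> z\<bar> \<le> ball_factor TYPE('a) * L * e n" for n
  proof -
    define r where "r = e n"
    have r: "r > 0" using e by (simp add: r_def)
    have [measurable]: "ball (0::'a) r \<in> sets borel" by simp
    have bi: "integrable lborel (\<lambda>y. c * indicator (ball (0::'a) r) y)" for c :: real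
      using emeasure_lborel_ball_finite[of "0::'a" r]
      by (intro integrable_mult_right integrable_real_indicator) (auto simp: less_top)
    have le: "\<bar>(\<psi> (y + z) - \<psi> z) * indicator (ball 0 r) y\<bar> \<le> L * r * indicator (ball 0 r) y" for y
    proof (cases "y \<in> ball 0 r")
      case True
      then have "L * norm y \<le> L * r" using L by (intro mult_left_mono) auto
      then show ?thesis using lip[of z y] True by (simp add: add.commute)
    qed simp
    have di: "integrable lborel (\<lambda>y. (\<psi> (y + z) - \<psi> z) * indicator (ball 0 r) y)"
      using le by (intro Bochner_Integration.integrable_bound[OF bi[of "L * r"]]) (use r in \<open>auto simp: abs_mult L\<close>)
    have split: "(\<integral>y. \<psi> (y + z) * indicator (ball 0 r) y \<partial>lborel)
        = (\<integral>y. (\<psi> (y + z) - \<psi> z) * indicator (ball 0 r) y \<partial>lborel) + \<psi> z * measure lborel (ball (0::'a) r)"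
    proof -
      have "(\<integral>y. \<psi> (y + z) * indicator (ball 0 r) y \<partial>lborel)
         = (\<integral>y. (\<psi> (y + z) - \<psi> z) * indicator (ball 0 r) y + \<psi> z * indicator (ball 0 r) y \<partial>lborel)"
        by (simp add: algebra_simps)
      also have "\<dots> = (\<integral>y. (\<psi> (y + z) - \<psi> z) * indicator (ball 0 r) y \<partial>lborel)
          + (\<integral>y. \<psi> z * indicator (ball (0::'a) r) y \<partial>lborel)"
        using di bi by (intro Bochner_Integration.integral_add) auto
      finally show ?thesis by simp
    qed
    have m: "measure lborel (ball (0::'a) r) = r ^ DIM('a) * measure lborel (ball (0::'a) 1)"
      using content_ball_conv_unit_ball[of r "0::'a"] r by simp
    have "\<bar>\<integral>y. (\<psi> (y + z) - \<psi> z) * indicator (ball 0 r) y \<partial>lborel\<bar>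
        \<le> (\<integral>y. \<bar>(\<psi> (y + z) - \<psi> z) * indicator (ball 0 r) y\<bar> \<partial>lborel)"
      by (rule integral_abs_bound)
    also have "\<dots> \<le> (\<integral>y. L * r * indicator (ball (0::'a) r) y \<partial>lborel)"
      using di by (intro integral_mono bi le) auto
    also have "\<dots> = L * r * measure lborel (ball (0::'a) r)" by simp
    finally have est: "\<bar>\<integral>y. (\<psi> (y + z) - \<psi> z) * indicator (ball 0 r) y \<partial>lborel\<bar>
        \<le> L * r * (r ^ DIM('a) * measure lborel (ball (0::'a) 1))" (is "\<bar>?J\<bar> \<le> _") unfolding m .
    have alg: "(a / q) * (j + p * (q * m)) - a * m * p = (a / q) * j" if "q > 0" for a q j p m :: real
      using that by (simp add: field_simps)
    have "?A n - ball_factor TYPE('a) * \<psi> z = (DIM('a) / r ^ DIM('a)) * ?J"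
      unfolding ball_factor_def r_def[symmetric] split m
      by (rule alg[of "r ^ DIM('a)" "DIM('a)" ?J "\<psi> z" "measure lborel (ball (0::'a) 1)"]) (use r in simp)
    then have "\<bar>?A n - ball_factor TYPE('a) * \<psi> z\<bar> = (DIM('a) / r ^ DIM('a)) * \<bar>?J\<bar>"
      using r by (simp add: abs_mult)
    also have "\<dots> \<le> (DIM('a) / r ^ DIM('a)) * (L * r * (r ^ DIM('a) * measure lborel (ball (0::'a) 1)))"
      using r est by (intro mult_left_mono) auto
    also have "\<dots> = ball_factor TYPE('a) * L * e n"
      using r by (simp add: ball_factor_def r_def)
    finally show ?thesis .
  qed
  have l: "(\<lambda>n. ball_factor TYPE('a) * L * e n) \<longlonglongrightarrow> 0"
    using tendsto_mult_left[OF e(1), of "ball_factor TYPE('a) * L"] by simp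
  have "(\<lambda>n. ?A n - ball_factor TYPE('a) * \<psi> z) \<longlonglongrightarrow> 0"
    by (rule Lim_null_comparison[OF _ l]) (use b in simp)
  then show ?thesis by (rule LIM_zero_cancel)
qed

text \<open>This is the weak form of the Poisson equation. With the truncated kernel, Fubini moves
  the gradient of \<psi> onto the kernel and leaves ball averages of \<psi>; letting the truncation
  radius tend to 0 on both sides gives the claim. The data \<open>f\<close> is merely bounded and
  integrable, so no second derivatives of its potential are available.\<close>

lemma newtonian_gradient_weak:
  fixes f \<psi> :: "'a::euclidean_space \<Rightarrow> real" and g :: "'a \<Rightarrow> 'a"
  assumes f: "integrable lborel f" and bd: "\<And>x. \<bar>f x\<bar> \<le> M"
    and \<psi>: "\<And>x. (\<psi> has_derivative (\<lambda>h. g x \<bullet> h)) (at x)"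
    and g: "continuous_on UNIV g"
    and supp: "\<And>x. norm x > R \<Longrightarrow> \<psi> x = 0"
  shows "integrable lborel (\<lambda>x. newtonian_gradient f x \<bullet> g x)"
    and "(\<integral>x. newtonian_gradient f x \<bullet> g x \<partial>lborel) = (\<integral>x. f x * \<psi> x \<partial>lborel)"
proof -
  define c where "c = ball_factor TYPE('a)"
  have c: "c > 0" by (simp add: c_def ball_factor_pos)
  define e where "e n = inverse (real (Suc n))" for n
  have e: "e \<longlonglongrightarrow> 0" "\<And>n. e n > 0"
    using LIMSEQ_inverse_real_of_nat by (auto simp: e_def[abs_def])
  define W where "W = M * (\<integral>y. kernel_near (y::'a) \<partial>lborel) + (\<integral>z. \<bar>f z\<bar> \<partial>lborel)"
  define N where "N n x = (\<integral>z. f z *\<^sub>R trunc_kernel (e n) (x - z) \<partial>lborel)" for n x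
  note N = trunc_convolution[OF f bd e, folded N_def c_def W_def]
  have \<psi>c: "continuous_on UNIV \<psi>"
    using \<psi> by (meson continuous_at_imp_continuous_on has_derivative_continuous)
  have [measurable]: "\<psi> \<in> borel_measurable borel" "g \<in> borel_measurable borel" "f \<in> borel_measurable borel"
    using \<psi>c g f by (auto intro: borel_measurable_continuous_onI)
  have [measurable]: "newtonian_gradient f \<in> borel_measurable borel"
    by (rule newtonian_gradient_measurable) simp
  have gs: "g x = 0" if "norm x > R" for x
    using has_derivative_zero_outside_support[OF \<psi> supp that] by (metis inner_eq_zero_iff)
  obtain B where B: "norm (g x) \<le> B" for x
    using continuous_compact_support_bounded[OF continuous_on_norm[OF g], of R] gs
    by (metis abs_norm_cancel norm_zero)
  obtain A where A: "\<bar>\<psi> x\<bar> \<le> A" for x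
    using continuous_compact_support_bounded[OF \<psi>c supp] by blast
  have gi: "integrable lborel (\<lambda>x. norm (g x))"
    using gs g by (intro integrable_continuous_compact_support[where R=R]) (auto intro: continuous_on_norm)
  have [measurable]: "N n \<in> borel_measurable borel" for n
  proof -
    have "N n \<in> borel_measurable lborel"
      unfolding N_def[abs_def] by (rule lborel.borel_measurable_lebesgue_integral) measurable
    then show ?thesis by simp
  qed
  have dom: "\<bar>N n x \<bullet> g x\<bar> \<le> W * norm (g x)" for n x
    by (rule order_trans[OF Cauchy_Schwarz_ineq2]) (intro mult_right_mono N norm_ge_zero)
  have lim: "(\<lambda>n. N n x \<bullet> g x) \<longlonglongrightarrow> - c * (newtonian_gradient f x \<bullet> g x)" for x
    using tendsto_inner[OF N(1)[of x] tendsto_const[of "g x"]] by simp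
  have l1: "(\<lambda>n. \<integral>x. N n x \<bullet> g x \<partial>lborel) \<longlonglongrightarrow> (\<integral>x. - c * (newtonian_gradient f x \<bullet> g x) \<partial>lborel)"
    by (rule integral_dominated_convergence[where w="\<lambda>x. W * norm (g x)"])
      (use gi lim dom in auto)
  have "integrable lborel (\<lambda>x. - c * (newtonian_gradient f x \<bullet> g x))"
    by (rule integrable_dominated_convergence[where w="\<lambda>x. W * norm (g x)" and s="\<lambda>n x. N n x \<bullet> g x"])
      (use gi lim dom in auto)
  then show "integrable lborel (\<lambda>x. newtonian_gradient f x \<bullet> g x)" using c by simp
  \<comment> \<open>Up to sign, this ball average of \<psi> around \<open>z\<close> is what remains
    of the inner integral over \<open>x\<close>.\<close>
  define J where "J n z = (DIM('a) / e n ^ DIM('a)) * (\<integral>y. \<psi> (y + z) * indicator (ball 0 (e n)) y \<partial>lborel)" for n z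
  have [measurable]: "ball (0::'a) r \<in> sets borel" for r by simp
  have [measurable]: "J n \<in> borel_measurable borel" for n
  proof -
    have "(\<lambda>z. \<integral>y. \<psi> (y + z) * indicator (ball 0 (e n)) y \<partial>lborel) \<in> borel_measurable lborel"
      by (rule lborel.borel_measurable_lebesgue_integral) measurable
    then show ?thesis unfolding J_def[abs_def] by simp
  qed
  have J: "(\<integral>x. trunc_kernel (e n) (x - z) \<bullet> g x \<partial>lborel) = - J n z" for n z
  proof -
    have "(\<integral>x. trunc_kernel (e n) (x - z) \<bullet> g x \<partial>lborel)
        = (\<integral>x. trunc_kernel (e n) ((x + z) - z) \<bullet> g (x + z) \<partial>lborel)"
      by (rule lborel_integral_translation[symmetric]) measurable
    also have "\<dots> = (\<integral>x. trunc_kernel (e n) x \<bullet> g (x + z) \<partial>lborel)" by simp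
    also have "\<dots> = - J n z"
      unfolding J_def minus_mult_left
    proof (rule integral_trunc_kernel_inner_gradient[OF _ _ _ e(2)])
      show "((\<lambda>y. \<psi> (y + z)) has_derivative (\<lambda>h. g (y + z) \<bullet> h)) (at y)" for y
        by (rule has_derivative_compose[OF _ \<psi>, of "\<lambda>y. y + z" "\<lambda>h. h"]) (auto intro!: derivative_eq_intros)
      show "continuous_on UNIV (\<lambda>y. g (y + z))"
        by (rule continuous_on_compose2[OF g]) (auto intro!: continuous_intros)
      \<comment> \<open>The support radius depends on \<open>z\<close>, which is harmless: the
        identity being applied does not mention it.\<close>
      show "\<psi> (y + z) = 0" if "norm y > R + norm z" for y
        using norm_triangle_ineq4[of "y + z" z] that by (intro supp) simp
    qed
    finally show ?thesis .
  qed
  have swap: "(\<integral>x. N n x \<bullet> g x \<partial>lborel) = (\<integral>z. - (f z * J n z) \<partial>lborel)" for n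
  proof -
    define P where "P = e n / e n ^ DIM('a)"
    have P: "norm (trunc_kernel (e n) y) \<le> P" for y :: 'a
      unfolding P_def by (rule norm_trunc_kernel_bound[OF e(2)])
    define h where "h x z = f z * (trunc_kernel (e n) (x - z) \<bullet> g x)" for x z
    \<comment> \<open>A product of an integrable function of \<open>x\<close> and one of
      \<open>z\<close> dominates the double integrand. The constant \<open>P\<close> depends on
      \<open>n\<close>, which is fixed here.\<close>
    have hle: "\<bar>h x z\<bar> \<le> P * norm (g x) * \<bar>f z\<bar>" for x z
    proof -
      have "\<bar>trunc_kernel (e n) (x - z) \<bullet> g x\<bar> \<le> P * norm (g x)"
        by (rule order_trans[OF Cauchy_Schwarz_ineq2]) (intro mult_right_mono P norm_ge_zero)
      from mult_left_mono[OF this, of "\<bar>f z\<bar>"] show ?thesis by (simp add: h_def abs_mult mult_ac)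
    qed
    have [measurable]: "case_prod h \<in> borel_measurable (lborel \<Otimes>\<^sub>M lborel)"
      unfolding h_def[abs_def] by measurable
    have hx: "integrable lborel (h x)" for x
    proof (rule Bochner_Integration.integrable_bound[of _ "\<lambda>z. P * norm (g x) * \<bar>f z\<bar>"])
      show "integrable lborel (\<lambda>z. P * norm (g x) * \<bar>f z\<bar>)" using f by auto
      show "h x \<in> borel_measurable lborel" unfolding h_def by measurable
      show "AE z in lborel. norm (h x z) \<le> norm (P * norm (g x) * \<bar>f z\<bar>)"
        using order_trans[OF hle abs_ge_self] by (auto intro!: AE_I2)
    qed
    have hi: "integrable (lborel \<Otimes>\<^sub>M lborel) (case_prod h)"
    proof (rule lborel_pair.Fubini_integrable)
      show "integrable lborel (\<lambda>x. \<integral>z. norm (case_prod h (x, z)) \<partial>lborel)"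
      proof (rule Bochner_Integration.integrable_bound[of _ "\<lambda>x. P * (\<integral>z. \<bar>f z\<bar> \<partial>lborel) * norm (g x)"])
        show "integrable lborel (\<lambda>x. P * (\<integral>z. \<bar>f z\<bar> \<partial>lborel) * norm (g x))" using gi by auto
        show "(\<lambda>x. \<integral>z. norm (case_prod h (x, z)) \<partial>lborel) \<in> borel_measurable lborel"
          by (rule lborel.borel_measurable_lebesgue_integral) measurable
        show "AE x in lborel. norm (\<integral>z. norm (case_prod h (x, z)) \<partial>lborel)
            \<le> norm (P * (\<integral>z. \<bar>f z\<bar> \<partial>lborel) * norm (g x))"
        proof (rule AE_I2)
          fix x
          have "(\<integral>z. \<bar>h x z\<bar> \<partial>lborel) \<le> (\<integral>z. P * norm (g x) * \<bar>f z\<bar> \<partial>lborel)"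
            using hx f by (intro integral_mono hle) auto
          then show "norm (\<integral>z. norm (case_prod h (x, z)) \<partial>lborel)
              \<le> norm (P * (\<integral>z. \<bar>f z\<bar> \<partial>lborel) * norm (g x))"
            by (simp add: mult_ac)
        qed
      qed
      show "AE x in lborel. integrable lborel (\<lambda>z. case_prod h (x, z))" using hx by simp
    qed measurable
    have Ni: "integrable lborel (\<lambda>z. f z *\<^sub>R trunc_kernel (e n) (x - z))" for x
    proof (rule Bochner_Integration.integrable_bound[of _ "\<lambda>z. P * f z"])
      show "AE z in lborel. norm (f z *\<^sub>R trunc_kernel (e n) (x - z)) \<le> norm (P * f z)"
      proof (rule AE_I2)
        fix z
        have "norm (f z *\<^sub>R trunc_kernel (e n) (x - z)) \<le> \<bar>f z\<bar> * P"
          using mult_left_mono[OF P, of "\<bar>f z\<bar>"] by simp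
        also have "\<dots> \<le> \<bar>f z\<bar> * \<bar>P\<bar>" by (intro mult_left_mono) auto
        also have "\<dots> = norm (P * f z)" by (simp add: abs_mult)
        finally show "norm (f z *\<^sub>R trunc_kernel (e n) (x - z)) \<le> norm (P * f z)" .
      qed
    qed (use f in auto)
    have "N n x \<bullet> g x = (\<integral>z. h x z \<partial>lborel)" for x
      unfolding N_def h_def using integral_inner_left[OF Ni[of x], of "g x"] by simp
    then have "(\<integral>x. N n x \<bullet> g x \<partial>lborel) = (\<integral>x. (\<integral>z. h x z \<partial>lborel) \<partial>lborel)"
      by simp
    also have "\<dots> = (\<integral>z. (\<integral>x. h x z \<partial>lborel) \<partial>lborel)"
      by (rule lborel_pair.Fubini_integral[OF hi, symmetric])
    also have "\<dots> = (\<integral>z. - (f z * J n z) \<partial>lborel)"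
      by (simp add: h_def J)
    finally show ?thesis .
  qed
  \<comment> \<open>The volume of the ball cancels \<open>e n ^ d\<close>, so this bound, unlike the
    one for the kernel, is uniform in \<open>n\<close>.\<close>
  have J_le: "\<bar>J n z\<bar> \<le> c * A" for n z
  proof -
    define r where "r = e n"
    have r: "r > 0" using e by (simp add: r_def)
    have A0: "A \<ge> 0" using A[of 0] by linarith
    have bi: "integrable lborel (\<lambda>y. A * indicator (ball (0::'a) r) y)"
      using emeasure_lborel_ball_finite[of "0::'a" r]
      by (intro integrable_mult_right integrable_real_indicator) (auto simp: less_top)
    have le: "\<bar>\<psi> (y + z) * indicator (ball 0 r) y\<bar> \<le> A * indicator (ball 0 r) y" for y
      using A[of "y + z"] by (auto simp: indicator_def)
    have "integrable lborel (\<lambda>y. \<psi> (y + z) * indicator (ball 0 r) y)"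
      using le by (intro Bochner_Integration.integrable_bound[OF bi]) (use A0 in \<open>auto simp: abs_mult\<close>)
    then have "\<bar>\<integral>y. \<psi> (y + z) * indicator (ball 0 r) y \<partial>lborel\<bar> \<le> (\<integral>y. A * indicator (ball (0::'a) r) y \<partial>lborel)"
      by (intro order_trans[OF integral_abs_bound] integral_mono bi le) auto
    also have "\<dots> = A * (r ^ DIM('a) * measure lborel (ball (0::'a) 1))"
      using content_ball_conv_unit_ball[of r "0::'a"] r by simp
    finally have "(DIM('a) / r ^ DIM('a)) * \<bar>\<integral>y. \<psi> (y + z) * indicator (ball 0 r) y \<partial>lborel\<bar>
        \<le> (DIM('a) / r ^ DIM('a)) * (A * (r ^ DIM('a) * measure lborel (ball (0::'a) 1)))"
      using r by (intro mult_left_mono) auto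
    also have "\<dots> = c * A" using r by (simp add: c_def ball_factor_def)
    finally show ?thesis using r by (simp add: J_def r_def abs_mult)
  qed
  have "(\<lambda>n. \<integral>z. - (f z * J n z) \<partial>lborel) \<longlonglongrightarrow> (\<integral>z. - (f z * (c * \<psi> z)) \<partial>lborel)"
  proof (rule integral_dominated_convergence[where w="\<lambda>z. c * A * \<bar>f z\<bar>"])
    show "AE z in lborel. (\<lambda>n. - (f z * J n z)) \<longlonglongrightarrow> - (f z * (c * \<psi> z))"
      using ball_average_tendsto[OF \<psi>c has_derivative_inner_lipschitz[OF \<psi> B] e]
      by (intro AE_I2 tendsto_minus tendsto_mult_left) (simp add: J_def c_def)
    show "AE z in lborel. norm (- (f z * J n z)) \<le> c * A * \<bar>f z\<bar>" for n
      using mult_right_mono[OF J_le abs_ge_zero] by (intro AE_I2) (simp add: abs_mult mult.commute)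
  qed (use f in auto)
  then have "(\<lambda>n. \<integral>x. N n x \<bullet> g x \<partial>lborel) \<longlonglongrightarrow> (\<integral>z. - (f z * (c * \<psi> z)) \<partial>lborel)"
    by (simp add: swap)
  from LIMSEQ_unique[OF l1 this]
  have "- c * (\<integral>x. newtonian_gradient f x \<bullet> g x \<partial>lborel) = - c * (\<integral>x. f x * \<psi> x \<partial>lborel)"
    by (simp add: mult.left_commute)
  then show "(\<integral>x. newtonian_gradient f x \<bullet> g x \<partial>lborel) = (\<integral>x. f x * \<psi> x \<partial>lborel)"
    using c by simp
qed

section \<open>Cutoff functions\<close>

text \<open>Only \<open>s = 0\<close> needs an argument: there the difference quotient is
  \<open>max h 0 ^ Suc k\<close>, which tends to 0. Squares of positive parts are thus C^1 and cubes
  are C^2.\<close>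

lemma has_real_derivative_max_power:
  "((\<lambda>s. max s 0 ^ Suc (Suc k)) has_real_derivative real (Suc (Suc k)) * max s 0 ^ Suc k) (at s)"
proof -
  consider "s > 0" | "s < 0" | "s = 0" by linarith
  then show ?thesis
  proof cases
    case 1
    have "((\<lambda>s::real. s ^ Suc (Suc k)) has_real_derivative real (Suc (Suc k)) * s ^ Suc k) (at s)"
      by (rule DERIV_cong[OF DERIV_pow]) simp
    then have "((\<lambda>s. max s 0 ^ Suc (Suc k)) has_real_derivative real (Suc (Suc k)) * s ^ Suc k) (at s)"
      by (rule has_field_derivative_transform_within_open[OF _ open_greaterThan[of 0]]) (use 1 in auto)
    then show ?thesis using 1 by simp
  next
    case 2
    have "((\<lambda>s::real. 0) has_real_derivative 0) (at s)" by simp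
    then have "((\<lambda>s. max s 0 ^ Suc (Suc k)) has_real_derivative 0) (at s)"
      by (rule has_field_derivative_transform_within_open[OF _ open_lessThan[of 0]]) (use 2 in auto)
    then show ?thesis using 2 by simp
  next
    case 3
    have "((\<lambda>h::real. max h 0 ^ Suc k) \<longlongrightarrow> max 0 0 ^ Suc k) (at 0)"
      by (intro tendsto_intros)
    then have l: "((\<lambda>h::real. max h 0 ^ Suc k) \<longlongrightarrow> 0) (at 0)" by simp
    have "((\<lambda>h::real. max h 0 ^ Suc (Suc k) / h) \<longlongrightarrow> 0) (at 0)"
      by (rule Lim_transform_eventually[OF l])
        (auto simp: eventually_at max_def intro!: exI[of _ 1])
    then show ?thesis using 3 by (simp add: DERIV_def)
  qed
qed

lemma has_real_derivative_imp_continuous_on: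
  assumes "\<And>s::real. (\<phi> has_real_derivative \<phi>' s) (at s)"
  shows "continuous_on UNIV \<phi>"
  using assms by (meson DERIV_isCont continuous_at_imp_continuous_on)

lemma has_derivative_compose_real:
  assumes "(w has_derivative w') (at x)" and "(\<phi> has_real_derivative c) (at (w x))"
  shows "((\<lambda>x. \<phi> (w x)) has_derivative (\<lambda>h. c * w' h)) (at x)"
  using has_derivative_compose[OF assms(1) assms(2)[unfolded has_field_derivative_def]] .

text \<open>\<open>(1 - |x|\<^sup>2/R\<^sup>2)\<^sub>+\<^sup>3\<close> is not \<open>1\<close> on any ball, but it is \<open>C\<^sup>2\<close> and tends to \<open>1\<close> pointwise as \<open>R \<rightarrow> \<infinity>\<close>.\<close>

definition cutoff :: "real \<Rightarrow> 'a::euclidean_space \<Rightarrow> real" where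
  "cutoff R x = max (1 - (x \<bullet> x) / R\<^sup>2) 0 ^ 3"

definition cutoff_grad :: "real \<Rightarrow> 'a::euclidean_space \<Rightarrow> 'a" where
  "cutoff_grad R x = (- 6 / R\<^sup>2 * max (1 - (x \<bullet> x) / R\<^sup>2) 0 ^ 2) *\<^sub>R x"

definition cutoff_hess :: "real \<Rightarrow> 'a::euclidean_space \<Rightarrow> 'a \<Rightarrow> 'a" where
  "cutoff_hess R x h = (- 6 / R\<^sup>2 * max (1 - (x \<bullet> x) / R\<^sup>2) 0 ^ 2) *\<^sub>R h
     + (24 / (R\<^sup>2)\<^sup>2 * max (1 - (x \<bullet> x) / R\<^sup>2) 0 * (x \<bullet> h)) *\<^sub>R x"

lemma cutoff_has_derivative: "(cutoff R has_derivative (\<lambda>h. cutoff_grad R x \<bullet> h)) (at x)"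
proof -
  have "((\<lambda>x::'a. 1 - (x \<bullet> x) / R\<^sup>2) has_derivative (\<lambda>h. - (2 / R\<^sup>2) * (x \<bullet> h))) (at x)"
    by (auto intro!: derivative_eq_intros simp: inner_commute divide_inverse algebra_simps)
  from has_derivative_compose_real[OF this has_real_derivative_max_power[of 1]]
  show ?thesis
    by (simp add: cutoff_def[abs_def] cutoff_grad_def eval_nat_numeral mult_ac)
qed

lemma cutoff_grad_has_derivative: "(cutoff_grad R has_derivative cutoff_hess R x) (at x)"
proof -
  have "((\<lambda>x::'a. 1 - (x \<bullet> x) / R\<^sup>2) has_derivative (\<lambda>h. - (2 / R\<^sup>2) * (x \<bullet> h))) (at x)"
    by (auto intro!: derivative_eq_intros simp: inner_commute divide_inverse algebra_simps)
  from has_derivative_compose_real[OF this has_real_derivative_max_power[of 0]]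
  have "((\<lambda>x::'a. max (1 - (x \<bullet> x) / R\<^sup>2) 0 ^ 2) has_derivative
      (\<lambda>h. - (4 / R\<^sup>2) * max (1 - (x \<bullet> x) / R\<^sup>2) 0 * (x \<bullet> h))) (at x)"
    by (simp add: eval_nat_numeral mult_ac)
  from has_derivative_mult_right[OF this, of "- 6 / R\<^sup>2"]
  have "((\<lambda>x::'a. - 6 / R\<^sup>2 * max (1 - (x \<bullet> x) / R\<^sup>2) 0 ^ 2) has_derivative
      (\<lambda>h. 24 / (R\<^sup>2)\<^sup>2 * max (1 - (x \<bullet> x) / R\<^sup>2) 0 * (x \<bullet> h))) (at x)"
    by (simp add: power2_eq_square mult.assoc)
  from has_derivative_scaleR[OF this has_derivative_ident]
  show ?thesis
    by (simp add: cutoff_grad_def[abs_def] cutoff_hess_def[abs_def])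
qed

lemma continuous_cutoff_hess: "continuous_on UNIV (\<lambda>x. cutoff_hess R x h)"
  unfolding cutoff_hess_def divide_inverse by (intro continuous_intros)

lemma inner_self_div_le_1_iff:
  fixes x :: "'a::real_inner"
  assumes "R > 0"
  shows "(x \<bullet> x) / R\<^sup>2 \<le> 1 \<longleftrightarrow> norm x \<le> R"
proof -
  have "(x \<bullet> x) / R\<^sup>2 \<le> 1 \<longleftrightarrow> (norm x)\<^sup>2 \<le> R\<^sup>2"
    using assms by (simp add: power2_norm_eq_inner divide_le_eq)
  then show ?thesis using assms by (simp add: power2_le_iff_abs_le)
qed

lemma cutoff_support: "R > 0 \<Longrightarrow> norm x > R \<Longrightarrow> cutoff R x = 0"
  using inner_self_div_le_1_iff[of R x] by (simp add: cutoff_def max_def)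

lemma cutoff_range: "0 \<le> cutoff R x" "cutoff R x \<le> 1"
  by (auto simp: cutoff_def intro!: power_le_one)

lemma cutoff_tendsto_1: "(\<lambda>n. cutoff (real n) x) \<longlonglongrightarrow> 1"
proof -
  have "(\<lambda>n. (x \<bullet> x) * (inverse (real n))\<^sup>2) \<longlonglongrightarrow> (x \<bullet> x) * 0\<^sup>2"
    by (intro tendsto_intros lim_inverse_n)
  then have "(\<lambda>n. (x \<bullet> x) / (real n)\<^sup>2) \<longlonglongrightarrow> 0"
    by (simp add: divide_inverse power_inverse)
  then have "(\<lambda>n. cutoff (real n) x) \<longlonglongrightarrow> max (1 - 0) 0 ^ 3"
    unfolding cutoff_def by (intro tendsto_intros)
  then show ?thesis by simp
qed

lemma norm_cutoff_grad_le:
  assumes "R > 0"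
  shows "norm (cutoff_grad R x) \<le> 6 / R"
proof (cases "norm x \<le> R")
  case True
  define m where "m = max (1 - (x \<bullet> x) / R\<^sup>2) 0"
  have m: "0 \<le> m" "m \<le> 1" using assms by (auto simp: m_def)
  have "norm (cutoff_grad R x) = 6 / R\<^sup>2 * (m ^ 2 * norm x)"
    by (simp add: cutoff_grad_def m_def[symmetric] abs_mult)
  also have "m ^ 2 * norm x \<le> 1 * R"
    using m True by (intro mult_mono power_le_one) auto
  then have "6 / R\<^sup>2 * (m ^ 2 * norm x) \<le> 6 / R\<^sup>2 * (1 * R)"
    by (rule mult_left_mono) simp
  also have "\<dots> = 6 / R" using assms by (simp add: power2_eq_square)
  finally show ?thesis .
next
  case False
  then show ?thesis
    using inner_self_div_le_1_iff[of R x] assms by (simp add: cutoff_grad_def max_def)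
qed

text \<open>The multiple of the identity in \<open>cutoff_hess\<close> has trace at most
  \<open>6 d / R\<^sup>2\<close> in absolute value. The rank one part contributes at most
  \<open>24 / R\<^sup>2\<close>, since \<open>norm x \<le> R\<close> on the support.\<close>

lemma cutoff_laplacian_le:
  fixes x :: "'a::euclidean_space"
  assumes "R > 0"
  shows "\<bar>\<Sum>b\<in>Basis. cutoff_hess R x b \<bullet> b\<bar> \<le> (6 * DIM('a) + 24) / R\<^sup>2"
proof -
  define m where "m = max (1 - (x \<bullet> x) / R\<^sup>2) 0"
  have m: "0 \<le> m" "m \<le> 1" using assms by (auto simp: m_def)
  have s: "(\<Sum>b\<in>Basis. (x \<bullet> b) * (x \<bullet> b)) = x \<bullet> x" by (rule euclidean_inner[symmetric])
  have "(\<Sum>b\<in>Basis. cutoff_hess R x b \<bullet> b)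
      = (\<Sum>b\<in>(Basis::'a set). - 6 / R\<^sup>2 * m\<^sup>2 + 24 / (R\<^sup>2)\<^sup>2 * m * ((x \<bullet> b) * (x \<bullet> b)))"
    by (rule sum.cong) (auto simp: cutoff_hess_def m_def[symmetric] inner_diff_left)
  also have "\<dots> = - 6 * DIM('a) / R\<^sup>2 * m\<^sup>2 + 24 / (R\<^sup>2)\<^sup>2 * m * (x \<bullet> x)"
    by (simp add: sum_subtractf sum_divide_distrib[symmetric] sum_distrib_left[symmetric] s)
  finally have e: "(\<Sum>b\<in>Basis. cutoff_hess R x b \<bullet> b)
      = - (6 * DIM('a) / R\<^sup>2 * m\<^sup>2) + 24 / R\<^sup>2 * (m * ((x \<bullet> x) / R\<^sup>2))"
    by (simp add: power2_eq_square)
  have "m * ((x \<bullet> x) / R\<^sup>2) \<le> 1 * 1"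
  proof (cases "(x \<bullet> x) / R\<^sup>2 \<le> 1")
    case True
    then show ?thesis using m assms by (intro mult_mono) auto
  next
    case False
    then show ?thesis by (simp add: m_def)
  qed
  then have 1: "24 / R\<^sup>2 * (m * ((x \<bullet> x) / R\<^sup>2)) \<le> 24 / R\<^sup>2 * (1 * 1)"
    by (rule mult_left_mono) simp
  have 2: "6 * DIM('a) / R\<^sup>2 * m\<^sup>2 \<le> 6 * DIM('a) / R\<^sup>2 * 1"
    using m by (intro mult_left_mono power_le_one) auto
  have 3: "0 \<le> 24 / R\<^sup>2 * (m * ((x \<bullet> x) / R\<^sup>2))" "0 \<le> 6 * DIM('a) / R\<^sup>2 * m\<^sup>2"
    using m by auto
  have 4: "(6 * DIM('a) + 24) / R\<^sup>2 = 6 * DIM('a) / R\<^sup>2 * 1 + 24 / R\<^sup>2 * (1 * 1)"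
    by (simp add: add_divide_distrib)
  show ?thesis unfolding e 4 abs_le_iff using 1 2 3 by linarith
qed

section \<open>The entropy inequality\<close>

text \<open>This is the estimate at one fixed time with weight \<open>k\<close>. The right-hand side
  contains derivatives of the weight but none of \<open>w\<close>, so it becomes small for a wide
  cutoff. The functions \<open>f\<close> and \<open>f1\<close> are linked only through
  \<open>P\<close> and \<open>P_le\<close>, which keeps the corner of the mobility out of
  sight.\<close>

lemma weighted_dissipation:
  fixes w k :: "'a::euclidean_space \<Rightarrow> real" and gw gk :: "'a \<Rightarrow> 'a" and Hw Hk :: "'a \<Rightarrow> 'a \<Rightarrow> 'a"
  assumes w: "\<And>x. (w has_derivative (\<lambda>h. gw x \<bullet> h)) (at x)"
    and gw: "\<And>x. (gw has_derivative Hw x) (at x)"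
    and Hw: "\<And>h. continuous_on UNIV (\<lambda>x. Hw x h)"
    and k: "\<And>x. (k has_derivative (\<lambda>h. gk x \<bullet> h)) (at x)"
    and gk: "\<And>x. (gk has_derivative Hk x) (at x)"
    and Hk: "\<And>h. continuous_on UNIV (\<lambda>x. Hk x h)"
    and supp: "\<And>x. norm x > R \<Longrightarrow> k x = 0"
    and k0: "\<And>x. k x \<ge> 0"
    and \<phi>: "\<And>s. (\<phi> has_real_derivative \<phi>1 s) (at s)"
    and \<phi>1: "\<And>s. (\<phi>1 has_real_derivative \<phi>2 s) (at s)"
    and \<phi>2: "continuous_on UNIV \<phi>2" "\<And>s. \<phi>2 s \<ge> 0"
    and f: "continuous_on UNIV f" and f1: "continuous_on UNIV f1"
    and P: "\<And>s. (P has_real_derivative \<phi>1 s * f1 s) (at s)"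
    and P_le: "\<And>s. P s * s \<le> \<phi>1 s * f s * s"
    and wi: "integrable lborel w" and wb: "\<And>x. \<bar>w x\<bar> \<le> M"
    and \<epsilon>: "\<epsilon> \<ge> 0"
  shows "(\<integral>x. k x * \<phi>1 (w x) * (f1 (w x) * (gw x \<bullet> newtonian_gradient w x) - f (w x) * w x
            + \<epsilon> * (\<Sum>b\<in>Basis. Hw x b \<bullet> b)) \<partial>lborel)
    \<le> (\<integral>x. \<epsilon> * (\<phi> (w x) * (\<Sum>b\<in>Basis. Hk x b \<bullet> b)) - P (w x) * (newtonian_gradient w x \<bullet> gk x) \<partial>lborel)"
proof -
  let ?G = "newtonian_gradient w"
  have cw: "continuous_on UNIV w" and cgw: "continuous_on UNIV gw"
    and ck: "continuous_on UNIV k" and cgk: "continuous_on UNIV gk"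
    using w gw k gk by (meson continuous_at_imp_continuous_on has_derivative_continuous)+
  have comp: "continuous_on UNIV (\<lambda>x. p (w x))" if "continuous_on UNIV p" for p :: "real \<Rightarrow> real"
    using continuous_on_compose2[OF that cw] by simp
  note c\<phi> = comp[OF has_real_derivative_imp_continuous_on[OF \<phi>]]
    and c\<phi>1 = comp[OF has_real_derivative_imp_continuous_on[OF \<phi>1]]
    and c\<phi>2 = comp[OF \<phi>2(1)] and cP = comp[OF has_real_derivative_imp_continuous_on[OF P]]
    and cf = comp[OF f] and cf1 = comp[OF f1]
  note cont = cw cgw ck cgk c\<phi> c\<phi>1 c\<phi>2 cP cf cf1 Hw Hk
  have gks: "gk x = 0" if "norm x > R" for x
    using has_derivative_zero_outside_support[OF k supp that] by (metis inner_eq_zero_iff)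
  have Hks: "Hk x = (\<lambda>_. 0)" if nx: "norm x > R" for x
  proof -
    have "((\<lambda>_. 0) has_derivative Hk x) (at x)"
      by (rule has_derivative_transform_within_open[OF gk open_Compl[OF closed_cball[of 0 R]]])
        (use gks nx in auto)
    then show ?thesis using has_derivative_unique has_derivative_const by blast
  qed
  note zero = supp gks Hks
  have ci: "integrable lborel p" if "continuous_on UNIV p" "\<And>x. norm x > R \<Longrightarrow> p x = 0" for p :: "'a \<Rightarrow> real"
    using that by (rule integrable_continuous_compact_support)

  define C where "C b x = k x * \<phi>1 (w x) * (Hw x b \<bullet> b)" for b x
  define D where "D b x = \<phi> (w x) * (Hk x b \<bullet> b)" for b x
  have iC: "integrable lborel (C b)" for b
    unfolding C_def by (intro ci continuous_intros cont) (simp add: zero)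
  have iD: "integrable lborel (D b)" for b
    unfolding D_def by (intro ci continuous_intros cont) (simp add: zero)
  \<comment> \<open>Integrating by parts with \<open>k * \<phi>1 (w) * (gw \<bullet> b)\<close> and
    with \<open>\<phi> (w) * (gk \<bullet> b)\<close> produces the same mixed term \<open>A\<close>.
    Eliminating it leaves the integral of \<open>C\<close> equal to that of \<open>D - B\<close>,
    where \<open>B \<ge> 0\<close> is the dissipation.\<close>
  have CD: "(\<integral>x. C b x \<partial>lborel) \<le> (\<integral>x. D b x \<partial>lborel)" if b: "b \<in> Basis" for b
  proof -
    define A where "A x = (gk x \<bullet> b) * \<phi>1 (w x) * (gw x \<bullet> b)" for x
    define B where "B x = k x * \<phi>2 (w x) * (gw x \<bullet> b)\<^sup>2" for x
    have iA: "integrable lborel A"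
      unfolding A_def by (intro ci continuous_intros cont) (simp add: zero)
    have iB: "integrable lborel B"
      unfolding B_def by (intro ci continuous_intros cont) (simp add: zero)
    have "(\<integral>x. k x * (\<phi>1 (w x) * (Hw x b \<bullet> b) + \<phi>2 (w x) * (gw x \<bullet> b) * (gw x \<bullet> b))
          + (gk x \<bullet> b) * (\<phi>1 (w x) * (gw x \<bullet> b)) \<partial>lborel) = 0"
    proof (rule integral_partial_C1_eq_0[where R=R and F="\<lambda>x. k x * (\<phi>1 (w x) * (gw x \<bullet> b))" and
          F'="\<lambda>x h. k x * (\<phi>1 (w x) * (Hw x h \<bullet> b) + \<phi>2 (w x) * (gw x \<bullet> h) * (gw x \<bullet> b))
          + (gk x \<bullet> h) * (\<phi>1 (w x) * (gw x \<bullet> b))"])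
      fix x
      show "((\<lambda>x. k x * (\<phi>1 (w x) * (gw x \<bullet> b))) has_derivative
          (\<lambda>h. k x * (\<phi>1 (w x) * (Hw x h \<bullet> b) + \<phi>2 (w x) * (gw x \<bullet> h) * (gw x \<bullet> b))
          + (gk x \<bullet> h) * (\<phi>1 (w x) * (gw x \<bullet> b)))) (at x)"
        by (intro has_derivative_mult k has_derivative_compose_real[OF w \<phi>1] has_derivative_inner_left gw)
    next
      show "continuous_on UNIV (\<lambda>x. k x * (\<phi>1 (w x) * (Hw x b \<bullet> b) + \<phi>2 (w x) * (gw x \<bullet> b) * (gw x \<bullet> b))
          + (gk x \<bullet> b) * (\<phi>1 (w x) * (gw x \<bullet> b)))"
        by (intro continuous_intros cont)
    qed (simp add: zero)
    also have "(\<lambda>x. k x * (\<phi>1 (w x) * (Hw x b \<bullet> b) + \<phi>2 (w x) * (gw x \<bullet> b) * (gw x \<bullet> b))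
          + (gk x \<bullet> b) * (\<phi>1 (w x) * (gw x \<bullet> b))) = (\<lambda>x. C b x + B x + A x)"
      by (simp add: A_def B_def C_def fun_eq_iff algebra_simps power2_eq_square)
    finally have 1: "(\<integral>x. C b x \<partial>lborel) + (\<integral>x. B x \<partial>lborel) + (\<integral>x. A x \<partial>lborel) = 0"
      using iA iB iC by simp
    have "(\<integral>x. \<phi> (w x) * (Hk x b \<bullet> b) + \<phi>1 (w x) * (gw x \<bullet> b) * (gk x \<bullet> b) \<partial>lborel) = 0"
    proof (rule integral_partial_C1_eq_0[where R=R and F="\<lambda>x. \<phi> (w x) * (gk x \<bullet> b)" and
          F'="\<lambda>x h. \<phi> (w x) * (Hk x h \<bullet> b) + \<phi>1 (w x) * (gw x \<bullet> h) * (gk x \<bullet> b)"])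
      fix x
      show "((\<lambda>x. \<phi> (w x) * (gk x \<bullet> b)) has_derivative
          (\<lambda>h. \<phi> (w x) * (Hk x h \<bullet> b) + \<phi>1 (w x) * (gw x \<bullet> h) * (gk x \<bullet> b))) (at x)"
        by (intro has_derivative_mult has_derivative_compose_real[OF w \<phi>] has_derivative_inner_left gk)
    next
      show "continuous_on UNIV (\<lambda>x. \<phi> (w x) * (Hk x b \<bullet> b) + \<phi>1 (w x) * (gw x \<bullet> b) * (gk x \<bullet> b))"
        by (intro continuous_intros cont)
    qed (simp add: zero)
    also have "(\<lambda>x. \<phi> (w x) * (Hk x b \<bullet> b) + \<phi>1 (w x) * (gw x \<bullet> b) * (gk x \<bullet> b)) = (\<lambda>x. D b x + A x)"
      by (simp add: A_def D_def fun_eq_iff algebra_simps)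
    finally have 2: "(\<integral>x. D b x \<partial>lborel) + (\<integral>x. A x \<partial>lborel) = 0"
      using iA iD by simp
    have "(\<integral>x. B x \<partial>lborel) \<ge> 0"
      by (rule Bochner_Integration.integral_nonneg) (simp add: B_def k0 \<phi>2)
    with 1 2 show ?thesis by linarith
  qed

  \<comment> \<open>\<open>T\<close> is the weighted drift and \<open>S\<close> its cutoff error.
    Their sum is the Newtonian gradient tested against the gradient of \<open>k * P (w)\<close>, so
    the weak Poisson equation turns its integral into that of \<open>U\<close>. The reaction term
    \<open>V\<close> dominates \<open>U\<close>.\<close>
  define T where "T x = k x * \<phi>1 (w x) * f1 (w x) * (gw x \<bullet> ?G x)" for x
  define S where "S x = P (w x) * (?G x \<bullet> gk x)" for x
  define U where "U x = w x * (k x * P (w x))" for x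
  define V where "V x = k x * \<phi>1 (w x) * f (w x) * w x" for x
  have [measurable]: "?G \<in> borel_measurable borel"
    using wi by (intro newtonian_gradient_measurable) auto
  obtain K where K: "norm (?G x) \<le> K" for x
    using norm_newtonian_gradient_le[OF wi wb] by blast
  \<comment> \<open>The Newtonian gradient is known here only to be measurable and bounded, so the
    argument for continuous functions of compact support is applied to a majorant of
    \<open>S\<close>.\<close>
  have iS: "integrable lborel S"
  proof (rule Bochner_Integration.integrable_bound[where f="\<lambda>x. K * norm (P (w x) *\<^sub>R gk x)"])
    have [measurable]: "(\<lambda>x. P (w x)) \<in> borel_measurable borel" "gk \<in> borel_measurable borel"
      using cP cgk by (auto intro: borel_measurable_continuous_onI)
    show "S \<in> borel_measurable lborel" unfolding S_def by measurable
    show "integrable lborel (\<lambda>x. K * norm (P (w x) *\<^sub>R gk x))"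
      by (intro ci continuous_intros cont) (simp add: zero)
    have "norm (S x) \<le> K * norm (P (w x) *\<^sub>R gk x)" for x
    proof -
      have "norm (S x) = \<bar>?G x \<bullet> (P (w x) *\<^sub>R gk x)\<bar>" by (simp add: S_def)
      also have "\<dots> \<le> norm (?G x) * norm (P (w x) *\<^sub>R gk x)" by (rule Cauchy_Schwarz_ineq2)
      also have "\<dots> \<le> K * norm (P (w x) *\<^sub>R gk x)" by (intro mult_right_mono K norm_ge_zero)
      finally show ?thesis .
    qed
    from order_trans[OF this abs_ge_self] show "AE x in lborel. norm (S x) \<le> norm (K * norm (P (w x) *\<^sub>R gk x))"
      by simp
  qed
  have iU: "integrable lborel U"
    unfolding U_def by (intro ci continuous_intros cont) (simp add: zero)
  have iV: "integrable lborel V"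
    unfolding V_def by (intro ci continuous_intros cont) (simp add: zero)
  have UV: "(\<integral>x. U x \<partial>lborel) \<le> (\<integral>x. V x \<partial>lborel)"
  proof (rule integral_mono[OF iU iV])
    fix x
    show "U x \<le> V x"
      using mult_left_mono[OF P_le[of "w x"] k0[of x]] by (simp add: U_def V_def mult_ac)
  qed
  have weak: "integrable lborel (\<lambda>x. ?G x \<bullet> (k x *\<^sub>R ((\<phi>1 (w x) * f1 (w x)) *\<^sub>R gw x) + P (w x) *\<^sub>R gk x))"
    "(\<integral>x. ?G x \<bullet> (k x *\<^sub>R ((\<phi>1 (w x) * f1 (w x)) *\<^sub>R gw x) + P (w x) *\<^sub>R gk x) \<partial>lborel)
      = (\<integral>x. w x * (k x * P (w x)) \<partial>lborel)"
  proof -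
    have d: "((\<lambda>x. k x * P (w x)) has_derivative
        (\<lambda>h. (k x *\<^sub>R ((\<phi>1 (w x) * f1 (w x)) *\<^sub>R gw x) + P (w x) *\<^sub>R gk x) \<bullet> h)) (at x)" for x
      using has_derivative_mult[OF k has_derivative_compose_real[OF w P]]
      by (simp add: inner_add_left algebra_simps)
    have c: "continuous_on UNIV (\<lambda>x. k x *\<^sub>R ((\<phi>1 (w x) * f1 (w x)) *\<^sub>R gw x) + P (w x) *\<^sub>R gk x)"
      by (intro continuous_intros cont)
    have s: "k x * P (w x) = 0" if "norm x > R" for x using zero that by simp
    show "integrable lborel (\<lambda>x. ?G x \<bullet> (k x *\<^sub>R ((\<phi>1 (w x) * f1 (w x)) *\<^sub>R gw x) + P (w x) *\<^sub>R gk x))"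
      "(\<integral>x. ?G x \<bullet> (k x *\<^sub>R ((\<phi>1 (w x) * f1 (w x)) *\<^sub>R gw x) + P (w x) *\<^sub>R gk x) \<partial>lborel)
      = (\<integral>x. w x * (k x * P (w x)) \<partial>lborel)"
      using newtonian_gradient_weak[OF wi wb d c s] by auto
  qed
  have TS: "?G x \<bullet> (k x *\<^sub>R ((\<phi>1 (w x) * f1 (w x)) *\<^sub>R gw x) + P (w x) *\<^sub>R gk x) = T x + S x" for x
    by (simp add: T_def S_def inner_add_right inner_commute mult_ac)
  note weak = weak[unfolded TS, folded U_def]
  have iT: "integrable lborel T"
    using Bochner_Integration.integrable_diff[OF weak(1) iS] by simp
  have TU: "(\<integral>x. T x \<partial>lborel) = (\<integral>x. U x \<partial>lborel) - (\<integral>x. S x \<partial>lborel)"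
    using weak(2) iT iS by simp

  have "(\<integral>x. k x * \<phi>1 (w x) * (f1 (w x) * (gw x \<bullet> ?G x) - f (w x) * w x
            + \<epsilon> * (\<Sum>b\<in>Basis. Hw x b \<bullet> b)) \<partial>lborel)
      = (\<integral>x. T x - V x + \<epsilon> * (\<Sum>b\<in>Basis. C b x) \<partial>lborel)"
    by (simp add: T_def V_def C_def algebra_simps sum_distrib_left)
  also have "\<dots> = (\<integral>x. T x \<partial>lborel) - (\<integral>x. V x \<partial>lborel) + \<epsilon> * (\<Sum>b\<in>Basis. \<integral>x. C b x \<partial>lborel)"
    using iT iV iC by (simp add: Bochner_Integration.integral_sum)
  also have "\<dots> \<le> - (\<integral>x. S x \<partial>lborel) + \<epsilon> * (\<Sum>b\<in>Basis. \<integral>x. D b x \<partial>lborel)"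
  proof -
    have "\<epsilon> * (\<Sum>b\<in>Basis. \<integral>x. C b x \<partial>lborel) \<le> \<epsilon> * (\<Sum>b\<in>Basis. \<integral>x. D b x \<partial>lborel)"
      by (intro mult_left_mono sum_mono CD \<epsilon>)
    with UV TU show ?thesis by linarith
  qed
  also have "\<dots> = (\<integral>x. \<epsilon> * (\<Sum>b\<in>Basis. D b x) - S x \<partial>lborel)"
    using iS iD by (simp add: Bochner_Integration.integral_sum)
  also have "\<dots> = (\<integral>x. \<epsilon> * (\<phi> (w x) * (\<Sum>b\<in>Basis. Hk x b \<bullet> b)) - P (w x) * (?G x \<bullet> gk x) \<partial>lborel)"
    by (simp add: D_def S_def sum_distrib_left)
  finally show ?thesis .
qed

section \<open>Decay of convex functionals in time\<close>

lemma has_derivative_gradient: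
  assumes "w differentiable (at x)"
  shows "(w has_derivative (\<lambda>h. gradient w x \<bullet> h)) (at x)"
proof -
  let ?D = "frechet_derivative w (at x)"
  have D: "(w has_derivative ?D) (at x)" using assms by (simp add: frechet_derivative_works)
  have "?D h = gradient w x \<bullet> h" for h
  proof -
    have "?D h = ?D (\<Sum>b\<in>Basis. (h \<bullet> b) *\<^sub>R b)" by (simp add: euclidean_representation)
    also have "\<dots> = (\<Sum>b\<in>Basis. (h \<bullet> b) * ?D b)"
      by (simp add: linear_sum[OF has_derivative_linear[OF D]] linear_scale[OF has_derivative_linear[OF D]])
    also have "\<dots> = gradient w x \<bullet> h"
      unfolding gradient_def inner_sum_left inner_scaleR_left
      by (intro sum.cong) (auto simp: inner_commute)
    finally show ?thesis .
  qed
  then have "?D = (\<lambda>h. gradient w x \<bullet> h)" by (rule ext)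
  then show ?thesis using D by metis
qed

lemma gradient_eqI:
  assumes "(w has_derivative (\<lambda>h. g \<bullet> h)) (at x)"
  shows "gradient w x = g"
  using frechet_derivative_at[OF assms, symmetric] by (simp add: gradient_def euclidean_representation)

text \<open>The reverse triangle inequality makes the L^1 norm continuous in time, hence bounded on
  a compact interval. The cutoff error needs this bound uniformly in time.\<close>

lemma continuous_into_L1_bounded:
  fixes u :: "real \<Rightarrow> 'a::euclidean_space \<Rightarrow> real"
  assumes "continuous_into_L1 u"
  obtains L where "\<And>t. 0 \<le> t \<Longrightarrow> t \<le> T \<Longrightarrow> (\<integral>x. \<bar>u t x\<bar> \<partial>lborel) \<le> L"
proof -
  have i: "integrable lborel (u t)" if "t \<ge> 0" for t
    using assms that by (simp add: continuous_into_L1_def)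
  have "continuous_on {0..} (\<lambda>t. \<integral>x. \<bar>u t x\<bar> \<partial>lborel)"
    unfolding continuous_on_def
  proof
    fix s :: real assume s: "s \<in> {0..}"
    have l: "((\<lambda>t. \<integral>x. \<bar>u t x - u s x\<bar> \<partial>lborel) \<longlongrightarrow> 0) (at s within {0..})"
      using assms s by (simp add: continuous_into_L1_def)
    have "eventually (\<lambda>t. norm ((\<integral>x. \<bar>u t x\<bar> \<partial>lborel) - (\<integral>x. \<bar>u s x\<bar> \<partial>lborel))
        \<le> (\<integral>x. \<bar>u t x - u s x\<bar> \<partial>lborel)) (at s within {0..})"
      unfolding eventually_at_filter
    proof (intro always_eventually allI impI)
      fix t :: real assume "t \<in> {0..}"
      then have it: "integrable lborel (u t)" and is': "integrable lborel (u s)" using i s by auto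
      have "(\<integral>x. \<bar>u t x\<bar> \<partial>lborel) - (\<integral>x. \<bar>u s x\<bar> \<partial>lborel) = (\<integral>x. \<bar>u t x\<bar> - \<bar>u s x\<bar> \<partial>lborel)"
        using it is' by simp
      also have "norm \<dots> \<le> (\<integral>x. \<bar>\<bar>u t x\<bar> - \<bar>u s x\<bar>\<bar> \<partial>lborel)"
        unfolding real_norm_def by (rule integral_abs_bound)
      also have "\<dots> \<le> (\<integral>x. \<bar>u t x - u s x\<bar> \<partial>lborel)"
        using it is' by (intro integral_mono) auto
      finally show "norm ((\<integral>x. \<bar>u t x\<bar> \<partial>lborel) - (\<integral>x. \<bar>u s x\<bar> \<partial>lborel))
        \<le> (\<integral>x. \<bar>u t x - u s x\<bar> \<partial>lborel)" .
    qed
    from Lim_null_comparison[OF this l]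
    show "((\<lambda>t. \<integral>x. \<bar>u t x\<bar> \<partial>lborel) \<longlongrightarrow> (\<integral>x. \<bar>u s x\<bar> \<partial>lborel)) (at s within {0..})"
      by (rule LIM_zero_cancel)
  qed
  then have "continuous_on {0..T} (\<lambda>t. \<integral>x. \<bar>u t x\<bar> \<partial>lborel)"
    by (rule continuous_on_subset) auto
  then have "bounded ((\<lambda>t. \<integral>x. \<bar>u t x\<bar> \<partial>lborel) ` {0..T})"
    by (intro compact_imp_bounded compact_continuous_image) auto
  then obtain L where L: "\<And>t. t \<in> {0..T} \<Longrightarrow> norm (\<integral>x. \<bar>u t x\<bar> \<partial>lborel) \<le> L"
    unfolding bounded_iff by blast
  show thesis
  proof (rule that[of L])
    fix t assume "0 \<le> t" "t \<le> T"
    then show "(\<integral>x. \<bar>u t x\<bar> \<partial>lborel) \<le> L" using L[of t] by auto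
  qed
qed

text \<open>The mean value theorem on \<open>[-M, M]\<close> gives linear growth from 0. In this way
  functions of a bounded integrable \<open>w\<close> inherit integrability from
  \<open>w\<close>.\<close>

lemma C1_linear_bound:
  fixes p p' :: "real \<Rightarrow> real"
  assumes "\<And>s. (p has_real_derivative p' s) (at s)" and "continuous_on UNIV p'" and "p 0 = 0"
  obtains c where "c \<ge> 0" and "\<And>s. \<bar>s\<bar> \<le> M \<Longrightarrow> \<bar>p s\<bar> \<le> c * \<bar>s\<bar>"
proof -
  have "bounded (p' ` cball 0 M)"
    using assms(2) by (intro compact_imp_bounded compact_continuous_image)
      (auto intro: continuous_on_subset)
  then obtain c where c: "\<And>s. s \<in> cball 0 M \<Longrightarrow> norm (p' s) \<le> c"
    unfolding bounded_iff by blast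
  have "\<bar>p s\<bar> \<le> max c 0 * \<bar>s\<bar>" if "\<bar>s\<bar> \<le> M" for s
  proof -
    have "norm (p s - p 0) \<le> max c 0 * norm (s - 0)"
    proof (rule field_differentiable_bound[of "cball 0 M"])
      show "(p has_field_derivative p' z) (at z within cball 0 M)" for z
        using assms(1) by (rule has_field_derivative_at_within)
      show "norm (p' z) \<le> max c 0" if "z \<in> cball 0 M" for z
        using c[OF that] by simp
    qed (use that in auto)
    then show ?thesis using assms(3) by simp
  qed
  then show thesis using that[of "max c 0"] by auto
qed

text \<open>The cube of half side \<open>R\<close> contains the ball of radius \<open>R\<close>.
  This links the gauge integral over a box, used for differentiation under the integral sign, with
  the Bochner integral used in the estimates.\<close>

lemma integral_cbox_eq_lborel:
  fixes F :: "'a::euclidean_space \<Rightarrow> real"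
  assumes "continuous_on UNIV F" and "\<And>x. norm x > R \<Longrightarrow> F x = 0"
  shows "integral (cbox (- R *\<^sub>R One) (R *\<^sub>R One)) F = (\<integral>x. F x \<partial>lborel)"
proof -
  have i: "integrable lborel F" by (rule integrable_continuous_compact_support[OF assms])
  have "F x = 0" if "x \<notin> cbox (- R *\<^sub>R One) (R *\<^sub>R One)" for x
  proof (rule assms(2), rule ccontr)
    assume "\<not> norm x > R"
    then have "\<bar>x \<bullet> b\<bar> \<le> R" if "b \<in> Basis" for b
      using Basis_le_norm[OF that, of x] by linarith
    then have "x \<in> cbox (- R *\<^sub>R One) (R *\<^sub>R One)"
      by (auto simp: mem_box abs_le_iff) (metis minus_le_iff)
    with that show False by blast
  qed
  then have "(\<lambda>x. if x \<in> cbox (- R *\<^sub>R One) (R *\<^sub>R One) then F x else 0) = F" by auto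
  then have "integral (cbox (- R *\<^sub>R One) (R *\<^sub>R One)) F = integral UNIV F"
    by (metis integral_restrict_UNIV)
  also have "\<dots> = (\<integral>x. F x \<partial>lborel)"
    by (rule integral_lborel[OF i])
  finally show ?thesis .
qed

lemma continuous_on_section:
  assumes "continuous_on (A \<times> UNIV) (\<lambda>(t, x). F t x)" and "t \<in> A"
  shows "continuous_on UNIV (F t)"
proof -
  have "continuous_on UNIV (\<lambda>x. case (t, x) of (t, x) \<Rightarrow> F t x)"
    by (rule continuous_on_compose2[OF assms(1)]) (use assms(2) in \<open>auto intro!: continuous_intros\<close>)
  then show ?thesis by simp
qed

text \<open>For each \<open>R \<ge> 1\<close> the localised functional has time derivative at most
  \<open>E * L / R\<close>, with constants uniform on \<open>[0, T]\<close>. It therefore grows by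
  at most \<open>T * E * L / R\<close>, which vanishes as \<open>R\<close> grows. The equation is
  used only where \<open>w > 0\<close>, because \<open>\<phi>1\<close> vanishes elsewhere.\<close>

lemma convex_functional_nonincreasing:
  fixes w :: "real \<Rightarrow> 'a::euclidean_space \<Rightarrow> real"
  assumes cont: "continuous_on ({0..} \<times> UNIV) (\<lambda>(t, x). w t x)"
    and bdd: "\<And>T. \<exists>M. \<forall>t\<in>{0..T}. \<forall>x. \<bar>w t x\<bar> \<le> M"
    and L1: "continuous_into_L1 w" and C12: "C12 w"
    and \<phi>: "\<And>s. (\<phi> has_real_derivative \<phi>1 s) (at s)"
    and \<phi>1: "\<And>s. (\<phi>1 has_real_derivative \<phi>2 s) (at s)"
    and \<phi>2: "continuous_on UNIV \<phi>2" "\<And>s. \<phi>2 s \<ge> 0"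
    and \<phi>_neg: "\<And>s. s \<le> 0 \<Longrightarrow> \<phi> s = 0" "\<And>s. s \<le> 0 \<Longrightarrow> \<phi>1 s = 0"
    and f: "continuous_on UNIV f" and f1: "continuous_on UNIV f1"
    and P: "\<And>s. (P has_real_derivative \<phi>1 s * f1 s) (at s)" and P0: "P 0 = 0"
    and P_le: "\<And>s. P s * s \<le> \<phi>1 s * f s * s"
    and \<epsilon>: "\<epsilon> \<ge> 0"
    and eq: "\<And>t x. t > 0 \<Longrightarrow> w t x > 0 \<Longrightarrow> deriv (\<lambda>s. w s x) t =
      f1 (w t x) * (gradient (w t) x \<bullet> newtonian_gradient (w t) x) - f (w t x) * w t x
        + \<epsilon> * laplacian (w t) x"
    and T: "T \<ge> 0"
  shows "integrable lborel (\<lambda>x. \<phi> (w T x))"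
    and "(\<integral>x. \<phi> (w T x) \<partial>lborel) \<le> (\<integral>x. \<phi> (w 0 x) \<partial>lborel)"
proof -
  obtain M where M: "\<And>t x. 0 \<le> t \<Longrightarrow> t \<le> T \<Longrightarrow> \<bar>w t x\<bar> \<le> M"
    using bdd[of T] unfolding Ball_def atLeastAtMost_iff by blast
  obtain L where L: "\<And>t. 0 \<le> t \<Longrightarrow> t \<le> T \<Longrightarrow> (\<integral>x. \<bar>w t x\<bar> \<partial>lborel) \<le> L"
    using continuous_into_L1_bounded[OF L1, of T] by blast
  have wi: "integrable lborel (w t)" if "t \<ge> 0" for t
    using L1 that by (simp add: continuous_into_L1_def)
  have c\<phi>: "continuous_on UNIV \<phi>" and c\<phi>1: "continuous_on UNIV \<phi>1" and cP: "continuous_on UNIV P"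
    by (rule has_real_derivative_imp_continuous_on[OF \<phi>] has_real_derivative_imp_continuous_on[OF \<phi>1]
        has_real_derivative_imp_continuous_on[OF P])+
  obtain c1 where c1: "c1 \<ge> 0" "\<And>s. \<bar>s\<bar> \<le> M \<Longrightarrow> \<bar>\<phi> s\<bar> \<le> c1 * \<bar>s\<bar>"
    using C1_linear_bound[OF \<phi> c\<phi>1, of M] \<phi>_neg(1)[of 0] by auto
  have "continuous_on UNIV (\<lambda>s. \<phi>1 s * f1 s)" using c\<phi>1 f1 by (intro continuous_intros)
  then obtain c2 where c2: "c2 \<ge> 0" "\<And>s. \<bar>s\<bar> \<le> M \<Longrightarrow> \<bar>P s\<bar> \<le> c2 * \<bar>s\<bar>"
    using C1_linear_bound[OF P _ P0, of M] by blast
  define K where "K = (M * (\<integral>y. kernel_near (y::'a) \<partial>lborel) + L) / ball_factor TYPE('a)"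
  have K: "norm (newtonian_gradient (w t) x) \<le> K" if "0 \<le> t" "t \<le> T" for t x
  proof -
    have "norm (newtonian_gradient (w t) x)
        \<le> (M * (\<integral>y. kernel_near (y::'a) \<partial>lborel) + (\<integral>z. \<bar>w t z\<bar> \<partial>lborel)) / ball_factor TYPE('a)"
      by (rule norm_newtonian_gradient_le[OF wi M]) (use that in auto)
    also have "\<dots> \<le> K"
      unfolding K_def using L[of t] that ball_factor_pos[where 'a='a]
      by (intro divide_right_mono) auto
    finally show ?thesis .
  qed
  have K0: "K \<ge> 0" using order_trans[OF norm_ge_zero K[of 0 0]] T by simp
  have wc: "continuous_on UNIV (w t)" if "t \<ge> 0" for t
    using continuous_on_section[OF cont] that by simp
  have \<phi>w: "integrable lborel (\<lambda>x. \<phi> (w t x))" if "0 \<le> t" "t \<le> T" for t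
  proof (rule Bochner_Integration.integrable_bound)
    show "integrable lborel (\<lambda>x. c1 * \<bar>w t x\<bar>)" using wi that by auto
    show "(\<lambda>x. \<phi> (w t x)) \<in> borel_measurable lborel"
      using continuous_on_compose2[OF c\<phi> wc, of t] that by (auto intro: borel_measurable_continuous_onI)
    show "AE x in lborel. norm (\<phi> (w t x)) \<le> norm (c1 * \<bar>w t x\<bar>)"
      using c1 M that by (auto intro!: AE_I2 simp: abs_mult)
  qed
  then show "integrable lborel (\<lambda>x. \<phi> (w T x))" using T by simp
  \<comment> \<open>The first summand collects the Laplacian of the cutoff, the second its gradient
    against the drift. Since \<open>R \<ge> 1\<close>, the decay \<open>1 / R\<^sup>2\<close> of the
    former is weakened to \<open>1 / R\<close>.\<close>
  define E where "E = \<epsilon> * c1 * (6 * DIM('a) + 24) + 6 * c2 * K"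
  have E0: "E \<ge> 0" using \<epsilon> c1 c2 K0 by (auto simp: E_def)
  define y where "y R t = integral (cbox (- R *\<^sub>R One) (R *\<^sub>R One)) (\<lambda>x. cutoff R (x::'a) * \<phi> (w t x))" for R t
  have cc: "continuous_on UNIV (cutoff R :: 'a \<Rightarrow> real)" for R
    using cutoff_has_derivative by (meson continuous_at_imp_continuous_on has_derivative_continuous)
  have cont_comp: "continuous_on (U \<times> S) (\<lambda>(t, x). cutoff R x * p (w t x))"
    if "U \<subseteq> {0..}" "continuous_on UNIV p" for U S R and p :: "real \<Rightarrow> real"
  proof -
    have 1: "continuous_on (U \<times> S) (\<lambda>z. w (fst z) (snd z))"
      using continuous_on_subset[OF cont, of "U \<times> S"] that by (auto simp: case_prod_beta')
    have "continuous_on (U \<times> S) (\<lambda>z. cutoff R (snd z) * p (w (fst z) (snd z)))"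
      by (intro continuous_on_mult continuous_on_compose2[OF that(2) 1] continuous_on_compose2[OF cc])
        (auto intro!: continuous_intros)
    then show ?thesis by (simp add: case_prod_beta')
  qed
  have y_eq: "y R t = (\<integral>x. cutoff R x * \<phi> (w t x) \<partial>lborel)" if "R > 0" "t \<ge> 0" for R t
    unfolding y_def
    using cc continuous_on_compose2[OF c\<phi> wc[OF that(2)]] cutoff_support[OF that(1)]
    by (intro integral_cbox_eq_lborel continuous_on_mult) auto
  have y_cont: "continuous_on {0..T} (y R)" for R
    unfolding y_def by (rule integral_continuous_on_param) (rule cont_comp[OF _ c\<phi>], auto)
  have y_deriv: "\<exists>D. (y R has_real_derivative D) (at t) \<and> D \<le> E * L / R"
    if t: "0 < t" "t \<le> T" and R: "R \<ge> 1" for t R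
  proof -
    let ?wt = "\<lambda>t x. deriv (\<lambda>s. w s x) t"
    have c_wt: "continuous_on ({0<..} \<times> UNIV) (\<lambda>(t, x). ?wt t x)"
      using C12 by (simp add: C12_def)
    have d_wt: "((\<lambda>s. w s x) has_real_derivative ?wt s x) (at s)" if "s > 0" for s x
      using C12 that by (auto simp: C12_def DERIV_deriv_iff_real_differentiable)
    have "((\<lambda>s. integral (cbox (- R *\<^sub>R One) (R *\<^sub>R One)) (\<lambda>x. cutoff R (x::'a) * \<phi> (w s x)))
        has_field_derivative integral (cbox (- R *\<^sub>R One) (R *\<^sub>R One))
          (\<lambda>x. cutoff R x * (\<phi>1 (w t x) * ?wt t x))) (at t within {0<..})"
    proof (rule leibniz_rule_field_derivative)
      show "((\<lambda>s. cutoff R x * \<phi> (w s x)) has_field_derivative cutoff R x * (\<phi>1 (w s x) * ?wt s x))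
          (at s within {0<..})" if "s \<in> {0<..}" for s and x :: 'a
        using that by (intro DERIV_cmult has_field_derivative_at_within[OF DERIV_chain2[OF \<phi> d_wt]]) auto
      show "(\<lambda>x. cutoff R x * \<phi> (w s x)) integrable_on cbox (- R *\<^sub>R One) (R *\<^sub>R One)"
        if "s \<in> {0<..}" for s
        using that continuous_on_compose2[OF c\<phi> wc, of s] cc
        by (intro integrable_continuous continuous_on_mult) (auto intro: continuous_on_subset)
      have "continuous_on ({0<..} \<times> cbox (- R *\<^sub>R One) (R *\<^sub>R One))
          (\<lambda>z. (case z of (t, x) \<Rightarrow> cutoff R (x::'a) * \<phi>1 (w t x)) * (case z of (t, x) \<Rightarrow> ?wt t x))"
        by (intro continuous_on_mult cont_comp[OF _ c\<phi>1] continuous_on_subset[OF c_wt]) auto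
      then show "continuous_on ({0<..} \<times> cbox (- R *\<^sub>R One) (R *\<^sub>R One))
          (\<lambda>(s, x). cutoff R (x::'a) * (\<phi>1 (w s x) * ?wt s x))"
        by (simp add: case_prod_beta' mult.assoc)
    qed (use t in auto)
    moreover have "integral (cbox (- R *\<^sub>R One) (R *\<^sub>R One)) (\<lambda>x. cutoff R (x::'a) * (\<phi>1 (w t x) * ?wt t x))
        = (\<integral>x. cutoff R x * (\<phi>1 (w t x) * ?wt t x) \<partial>lborel)"
    proof (rule integral_cbox_eq_lborel)
      have "continuous_on UNIV (?wt t)"
        using continuous_on_section[OF c_wt] t by simp
      then show "continuous_on UNIV (\<lambda>x. cutoff R x * (\<phi>1 (w t x) * ?wt t x))"
        using cc continuous_on_compose2[OF c\<phi>1 wc, of t] t by (intro continuous_on_mult) auto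
      show "cutoff R x * (\<phi>1 (w t x) * ?wt t x) = 0" if "norm x > R" for x
        using cutoff_support[of R x] that R by simp
    qed
    ultimately have yd: "(y R has_real_derivative
        (\<integral>x. cutoff R x * (\<phi>1 (w t x) * ?wt t x) \<partial>lborel)) (at t)"
      using t by (simp add: y_def[abs_def] at_within_open[of t "{0<..}"])
    have dx: "w t differentiable (at x)" "gradient (w t) differentiable (at x)" for x
      using C12 t by (auto simp: C12_def)
    have cH: "continuous_on UNIV (\<lambda>x. frechet_derivative (gradient (w t)) (at x) h)" for h
    proof -
      have "continuous_on ({0<..} \<times> UNIV) (\<lambda>(t, x). frechet_derivative (gradient (w t)) (at x) h)"
        using C12 by (simp add: C12_def)
      then show ?thesis using continuous_on_section t by fastforce
    qed
    have "(\<integral>x. cutoff R x * (\<phi>1 (w t x) * ?wt t x) \<partial>lborel)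
        = (\<integral>x. cutoff R x * \<phi>1 (w t x) * (f1 (w t x) * (gradient (w t) x \<bullet> newtonian_gradient (w t) x)
          - f (w t x) * w t x + \<epsilon> * (\<Sum>b\<in>Basis. frechet_derivative (gradient (w t)) (at x) b \<bullet> b)) \<partial>lborel)"
    proof (rule Bochner_Integration.integral_cong[OF refl])
      \<comment> \<open>Where \<open>w t x \<le> 0\<close> both sides are 0 by
        \<open>\<phi>1 (w t x) = 0\<close>; elsewhere the equation applies.\<close>
      fix x
      show "cutoff R x * (\<phi>1 (w t x) * ?wt t x) = cutoff R x * \<phi>1 (w t x) * (f1 (w t x) *
          (gradient (w t) x \<bullet> newtonian_gradient (w t) x)
          - f (w t x) * w t x + \<epsilon> * (\<Sum>b\<in>Basis. frechet_derivative (gradient (w t)) (at x) b \<bullet> b))"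
        using eq[OF t(1), of x] \<phi>_neg(2)[of "w t x"]
        by (cases "w t x > 0") (simp_all add: laplacian_def divergence_def)
    qed
    also have "\<dots> \<le> (\<integral>x. \<epsilon> * (\<phi> (w t x) * (\<Sum>b\<in>Basis. cutoff_hess R x b \<bullet> b))
        - P (w t x) * (newtonian_gradient (w t) x \<bullet> cutoff_grad R x) \<partial>lborel)"
    proof -
      have g: "(gradient (w t) has_derivative frechet_derivative (gradient (w t)) (at x)) (at x)" for x
        using dx by (simp add: frechet_derivative_works)
      have s: "cutoff R x = 0" if "norm x > R" for x :: 'a
        using cutoff_support[of R x] that R by simp
      have wM: "\<bar>w t x\<bar> \<le> M" for x using M t by simp
      have wi': "integrable lborel (w t)" using wi t by simp
      show ?thesis
        by (rule weighted_dissipation[OF has_derivative_gradient[OF dx(1)] g cH cutoff_has_derivative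
            cutoff_grad_has_derivative continuous_cutoff_hess s cutoff_range(1) \<phi> \<phi>1 \<phi>2 f f1 P P_le wi' wM \<epsilon>])
    qed
    \<comment> \<open>The comparison rule used here requires only that the majorant be integrable
      and nonnegative.\<close>
    also have "\<dots> \<le> (\<integral>x. E / R * \<bar>w t x\<bar> \<partial>lborel)"
    proof (rule integral_mono')
      show "integrable lborel (\<lambda>x. E / R * \<bar>w t x\<bar>)" using wi t by auto
      show "0 \<le> E / R * \<bar>w t x\<bar>" for x using E0 R by auto
      fix x
      have wM: "\<bar>w t x\<bar> \<le> M" using M t by simp
      have R2: "(6 * DIM('a) + 24) / R\<^sup>2 \<le> (6 * DIM('a) + 24) / R"
        using R by (intro divide_left_mono) (auto simp: power2_eq_square)
      have "\<epsilon> * (\<phi> (w t x) * (\<Sum>b\<in>Basis. cutoff_hess R x b \<bullet> b))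
          \<le> \<epsilon> * (\<bar>\<phi> (w t x)\<bar> * \<bar>\<Sum>b\<in>Basis. cutoff_hess R x b \<bullet> b\<bar>)"
        using \<epsilon> by (intro mult_left_mono) (auto simp: abs_mult[symmetric])
      also have "\<dots> \<le> \<epsilon> * ((c1 * \<bar>w t x\<bar>) * ((6 * DIM('a) + 24) / R))"
        using c1 wM cutoff_laplacian_le[of R x] R2 R \<epsilon> by (intro mult_left_mono mult_mono) auto
      finally have 1: "\<epsilon> * (\<phi> (w t x) * (\<Sum>b\<in>Basis. cutoff_hess R x b \<bullet> b))
          \<le> \<epsilon> * ((c1 * \<bar>w t x\<bar>) * ((6 * DIM('a) + 24) / R))" .
      have "\<bar>newtonian_gradient (w t) x \<bullet> cutoff_grad R x\<bar> \<le> K * (6 / R)"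
        using K[of t x] t norm_cutoff_grad_le[of R x] R K0
        by (intro order_trans[OF Cauchy_Schwarz_ineq2 mult_mono]) auto
      then have "\<bar>P (w t x) * (newtonian_gradient (w t) x \<bullet> cutoff_grad R x)\<bar> \<le> (c2 * \<bar>w t x\<bar>) * (K * (6 / R))"
        unfolding abs_mult using c2 wM by (intro mult_mono) auto
      then have 2: "- (P (w t x) * (newtonian_gradient (w t) x \<bullet> cutoff_grad R x)) \<le> (c2 * \<bar>w t x\<bar>) * (K * (6 / R))"
        by linarith
      have "\<epsilon> * ((c1 * \<bar>w t x\<bar>) * ((6 * DIM('a) + 24) / R)) + (c2 * \<bar>w t x\<bar>) * (K * (6 / R)) = E / R * \<bar>w t x\<bar>"
        using R by (simp add: E_def field_simps)
      with 1 2 show "\<epsilon> * (\<phi> (w t x) * (\<Sum>b\<in>Basis. cutoff_hess R x b \<bullet> b))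
        - P (w t x) * (newtonian_gradient (w t) x \<bullet> cutoff_grad R x) \<le> E / R * \<bar>w t x\<bar>"
        by linarith
    qed
    also have "\<dots> = E / R * (\<integral>x. \<bar>w t x\<bar> \<partial>lborel)" by simp
    also have "\<dots> \<le> E / R * L"
      using L[of t] t E0 R by (intro mult_left_mono) auto
    finally show ?thesis using yd by auto
  qed
  have y_le: "y R T \<le> y R 0 + T * (E * L) / R" if R: "R \<ge> 1" for R
  proof (cases "T = 0")
    case False
    then have T: "T > 0" using T by simp
    have "y R differentiable (at z)" if "0 < z" "z < T" for z
      using y_deriv[of z R] that R unfolding real_differentiable_def by auto
    from MVT[OF T y_cont this]
    obtain l z where z: "0 < z" "z < T" "(y R has_real_derivative l) (at z)" "y R T - y R 0 = (T - 0) * l"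
      by blast
    obtain D where "(y R has_real_derivative D) (at z)" "D \<le> E * L / R"
      using y_deriv[of z R] z R by auto
    then have "l \<le> E * L / R" using z(3) DERIV_unique by blast
    then have "T * l \<le> T * (E * L / R)" using T by (intro mult_left_mono) auto
    then show ?thesis using z(4) by simp
  qed simp
  have y_lim: "(\<lambda>n. y (real n) t) \<longlonglongrightarrow> (\<integral>x. \<phi> (w t x) \<partial>lborel)" if t: "0 \<le> t" "t \<le> T" for t
  proof -
    have [measurable]: "(\<lambda>x. \<phi> (w t x)) \<in> borel_measurable borel"
      using \<phi>w[OF t] by auto
    have [measurable]: "(cutoff R :: 'a \<Rightarrow> real) \<in> borel_measurable borel" for R
      using cc by (rule borel_measurable_continuous_onI)
    have "(\<lambda>n. \<integral>x. cutoff (real n) x * \<phi> (w t x) \<partial>lborel) \<longlonglongrightarrow> (\<integral>x. \<phi> (w t x) \<partial>lborel)"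
    proof (rule integral_dominated_convergence[where w="\<lambda>x. \<bar>\<phi> (w t x)\<bar>"])
      show "AE x in lborel. (\<lambda>n. cutoff (real n) x * \<phi> (w t x)) \<longlonglongrightarrow> \<phi> (w t x)"
      proof (rule AE_I2)
        fix x
        show "(\<lambda>n. cutoff (real n) x * \<phi> (w t x)) \<longlonglongrightarrow> \<phi> (w t x)"
          using tendsto_mult_right[OF cutoff_tendsto_1[of x], of "\<phi> (w t x)"] by simp
      qed
      show "AE x in lborel. norm (cutoff (real n) x * \<phi> (w t x)) \<le> \<bar>\<phi> (w t x)\<bar>" for n
      proof (rule AE_I2)
        fix x :: 'a
        have "\<bar>cutoff (real n) x\<bar> \<le> 1" using cutoff_range[of "real n" x] by simp
        from mult_right_mono[OF this, of "\<bar>\<phi> (w t x)\<bar>"]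
        show "norm (cutoff (real n) x * \<phi> (w t x)) \<le> \<bar>\<phi> (w t x)\<bar>" by (simp add: abs_mult)
      qed
    qed (use \<phi>w[OF t] in auto)
    moreover have "eventually (\<lambda>n. (\<integral>x. cutoff (real n) x * \<phi> (w t x) \<partial>lborel) = y (real n) t) sequentially"
      using eventually_gt_at_top[of 0] by eventually_elim (simp add: y_eq t)
    ultimately show ?thesis by (rule Lim_transform_eventually)
  qed
  have l0: "(\<lambda>n. y (real n) 0 + T * (E * L) / real n) \<longlonglongrightarrow> (\<integral>x. \<phi> (w 0 x) \<partial>lborel) + 0"
    using T by (intro tendsto_add y_lim lim_const_over_n) auto
  have "(\<integral>x. \<phi> (w T x) \<partial>lborel) \<le> (\<integral>x. \<phi> (w 0 x) \<partial>lborel) + 0"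
    by (rule LIMSEQ_le[OF y_lim[of T] l0]) (use T y_le in \<open>auto intro!: exI[of _ 1]\<close>)
  then show "(\<integral>x. \<phi> (w T x) \<partial>lborel) \<le> (\<integral>x. \<phi> (w 0 x) \<partial>lborel)" by simp
qed

text \<open>Integrating from 0 gives the function, but its derivative is obtained from the integral
  over \<open>{- N..x}\<close> with \<open>N = \<bar>s\<bar> + 1\<close>. The two agree because
  \<open>g\<close> vanishes on the negative axis, and \<open>s\<close> is interior to the larger
  interval, so the derivative is two-sided also at 0.\<close>

lemma antiderivative_vanishing_on_negative:
  fixes g :: "real \<Rightarrow> real"
  assumes g: "continuous_on UNIV g" and neg: "\<And>s. s \<le> 0 \<Longrightarrow> g s = 0"
  obtains P where "\<And>s. (P has_real_derivative g s) (at s)" and "\<And>s. s \<le> 0 \<Longrightarrow> P s = 0"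
proof -
  define P where "P s = integral {0..s} g" for s
  have gi: "g integrable_on {a..b}" for a b
    by (rule integrable_continuous_real) (rule continuous_on_subset[OF g], simp)
  have P_neg: "P s = 0" if "s \<le> 0" for s
    using that by (cases "s = 0") (auto simp: P_def)
  have "(P has_real_derivative g s) (at s)" for s
  proof -
    define N where "N = \<bar>s\<bar> + 1"
    have eq: "integral {- N..x} g = P x" if "x \<in> {- N<..<N}" for x
    proof -
      have z: "integral {- N..y} g = 0" if "y \<le> 0" for y
      proof -
        have "integral {- N..y} g = integral {- N..y} (\<lambda>_. 0)"
          using that by (intro integral_cong neg) auto
        then show ?thesis by simp
      qed
      show ?thesis
      proof (cases "x \<le> 0")
        case True
        then show ?thesis using z P_neg by simp
      next
        case False
        then have "integral {- N..0} g + integral {0..x} g = integral {- N..x} g"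
          using gi by (intro Henstock_Kurzweil_Integration.integral_combine) (auto simp: N_def)
        then show ?thesis using z[of 0] by (simp add: P_def)
      qed
    qed
    have "((\<lambda>x. integral {- N..x} g) has_real_derivative g s) (at s within {- N..N})"
      by (rule integral_has_real_derivative) (use continuous_on_subset[OF g] in \<open>auto simp: N_def\<close>)
    then have "((\<lambda>x. integral {- N..x} g) has_real_derivative g s) (at s)"
      by (subst (asm) at_within_interior) (auto simp: N_def)
    then show ?thesis
      by (rule has_field_derivative_transform_within_open[OF _ open_greaterThanLessThan[of "- N" N]])
        (use eq in \<open>auto simp: N_def\<close>)
  qed
  then show thesis using that P_neg by blast
qed

text \<open>This relation is all that the norm estimates need from the evolution. Integrability is
  part of it, because the Bochner integral of a non-integrable function is 0 and the inequality
  alone would carry no information.\<close>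

definition convex_dominated :: "('a::euclidean_space \<Rightarrow> real) \<Rightarrow> ('a \<Rightarrow> real) \<Rightarrow> bool" where
  "convex_dominated w w0 \<longleftrightarrow> (\<forall>\<phi> \<phi>1 \<phi>2. (\<forall>s. (\<phi> has_real_derivative \<phi>1 s) (at s)) \<longrightarrow>
     (\<forall>s. (\<phi>1 has_real_derivative \<phi>2 s) (at s)) \<longrightarrow> continuous_on UNIV \<phi>2 \<longrightarrow>
     (\<forall>s. \<phi>2 s \<ge> 0) \<longrightarrow> (\<forall>s\<le>0. \<phi> s = 0) \<longrightarrow> (\<forall>s\<le>0. \<phi>1 s = 0) \<longrightarrow>
     integrable lborel (\<lambda>x. \<phi> (w x)) \<and> integrable lborel (\<lambda>x. \<phi> (w0 x)) \<and>
     (\<integral>x. \<phi> (w x) \<partial>lborel) \<le> (\<integral>x. \<phi> (w0 x) \<partial>lborel))"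

lemma evolution_convex_dominated:
  fixes w :: "real \<Rightarrow> 'a::euclidean_space \<Rightarrow> real"
  assumes cont: "continuous_on ({0..} \<times> UNIV) (\<lambda>(t, x). w t x)"
    and bdd: "\<And>T. \<exists>M. \<forall>t\<in>{0..T}. \<forall>x. \<bar>w t x\<bar> \<le> M"
    and L1: "continuous_into_L1 w" and C12: "C12 w"
    and f: "continuous_on UNIV f" "\<And>s. f s \<ge> 0" and f1: "continuous_on UNIV f1"
    and ff1: "\<And>s. s > 0 \<Longrightarrow> (f has_real_derivative f1 s) (at s)"
    and \<epsilon>: "\<epsilon> \<ge> 0"
    and eq: "\<And>t x. t > 0 \<Longrightarrow> w t x > 0 \<Longrightarrow> deriv (\<lambda>s. w s x) t =
      f1 (w t x) * (gradient (w t) x \<bullet> newtonian_gradient (w t) x) - f (w t x) * w t x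
        + \<epsilon> * laplacian (w t) x"
    and T: "T \<ge> 0"
  shows "convex_dominated (w T) (w 0)"
  unfolding convex_dominated_def
proof (intro allI impI)
  fix \<phi> \<phi>1 \<phi>2 :: "real \<Rightarrow> real"
  assume \<phi>: "\<forall>s. (\<phi> has_real_derivative \<phi>1 s) (at s)"
    and \<phi>1: "\<forall>s. (\<phi>1 has_real_derivative \<phi>2 s) (at s)"
    and \<phi>2: "continuous_on UNIV \<phi>2" "\<forall>s. \<phi>2 s \<ge> 0"
    and neg: "\<forall>s\<le>0. \<phi> s = 0" "\<forall>s\<le>0. \<phi>1 s = 0"
  have c\<phi>1: "continuous_on UNIV \<phi>1"
    by (rule has_real_derivative_imp_continuous_on) (use \<phi>1 in blast)
  obtain P where P: "\<And>s. (P has_real_derivative \<phi>1 s * f1 s) (at s)" and P_neg: "\<And>s. s \<le> 0 \<Longrightarrow> P s = 0"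
    using antiderivative_vanishing_on_negative[of "\<lambda>s. \<phi>1 s * f1 s"] c\<phi>1 f1 neg(2)
    by (auto intro: continuous_on_mult)
  have P_le: "P s * s \<le> \<phi>1 s * f s * s" for s
  proof (cases "s \<le> 0")
    case True
    then show ?thesis using P_neg neg by simp
  next
    case False
    then have s: "s > 0" by simp
    \<comment> \<open>Differentiability is needed only in the open interval, so the corner of
      \<open>f\<close> at 0 is avoided and continuity suffices at the left end.\<close>
    have "\<phi>1 0 * f 0 - P 0 \<le> \<phi>1 s * f s - P s"
    proof (rule DERIV_nonneg_imp_increasing_open[of 0 s "\<lambda>s. \<phi>1 s * f s - P s"])
      fix x :: real assume x: "0 < x" "x < s"
      have "((\<lambda>s. \<phi>1 s * f s - P s) has_real_derivative \<phi>2 x * f x) (at x)"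
        using DERIV_diff[OF DERIV_mult[OF spec[OF \<phi>1] ff1[OF x(1)]] P] by (simp add: mult.commute)
      then show "\<exists>y. ((\<lambda>s. \<phi>1 s * f s - P s) has_real_derivative y) (at x) \<and> y \<ge> 0"
        using \<phi>2(2) f(2)[of x] by (intro exI[of _ "\<phi>2 x * f x"]) simp
    next
      have "continuous_on UNIV (\<lambda>s. \<phi>1 s * f s - P s)"
        using c\<phi>1 f(1) has_real_derivative_imp_continuous_on[OF P] by (intro continuous_intros)
      then show "continuous_on {0..s} (\<lambda>s. \<phi>1 s * f s - P s)"
        by (rule continuous_on_subset) simp
    qed (use s in simp)
    then have "P s \<le> \<phi>1 s * f s" using neg P_neg by simp
    then show ?thesis using s by (intro mult_right_mono) auto
  qed
  have neg': "\<phi> s = 0" "\<phi>1 s = 0" if "s \<le> 0" for s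
    using neg that by auto
  have "integrable lborel (\<lambda>x. \<phi> (w t x)) \<and> (\<integral>x. \<phi> (w t x) \<partial>lborel) \<le> (\<integral>x. \<phi> (w 0 x) \<partial>lborel)"
    if "t \<ge> 0" for t
    by (intro conjI; rule convex_functional_nonincreasing[OF cont bdd L1 C12 spec[OF \<phi>] spec[OF \<phi>1] \<phi>2(1)
      spec[OF \<phi>2(2)] neg' f(1) f1 P P_neg[OF order_refl] P_le \<epsilon> eq that])
  \<comment> \<open>The instance at time 0 supplies the integrability of
    \<open>\<phi> (w 0 x)\<close>.\<close>
  from this[OF T] this[of 0]
  show "integrable lborel (\<lambda>x. \<phi> (w T x)) \<and> integrable lborel (\<lambda>x. \<phi> (w 0 x)) \<and>
      (\<integral>x. \<phi> (w T x) \<partial>lborel) \<le> (\<integral>x. \<phi> (w 0 x) \<partial>lborel)"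
    by auto
qed

section \<open>From convex functionals to the norms\<close>

lemma convex_dominatedD:
  assumes "convex_dominated w w0"
    and "\<And>s. (\<phi> has_real_derivative \<phi>1 s) (at s)" and "\<And>s. (\<phi>1 has_real_derivative \<phi>2 s) (at s)"
    and "continuous_on UNIV \<phi>2" and "\<And>s. \<phi>2 s \<ge> 0"
    and "\<And>s. s \<le> 0 \<Longrightarrow> \<phi> s = 0" and "\<And>s. s \<le> 0 \<Longrightarrow> \<phi>1 s = 0"
  shows "integrable lborel (\<lambda>x. \<phi> (w x))" and "integrable lborel (\<lambda>x. \<phi> (w0 x))"
    and "(\<integral>x. \<phi> (w x) \<partial>lborel) \<le> (\<integral>x. \<phi> (w0 x) \<partial>lborel)"
proof -
  have "integrable lborel (\<lambda>x. \<phi> (w x)) \<and> integrable lborel (\<lambda>x. \<phi> (w0 x)) \<and>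
     (\<integral>x. \<phi> (w x) \<partial>lborel) \<le> (\<integral>x. \<phi> (w0 x) \<partial>lborel)"
    using assms(1)[unfolded convex_dominated_def, rule_format, of \<phi> \<phi>1 \<phi>2] assms(2-7) by blast
  then show "integrable lborel (\<lambda>x. \<phi> (w x))" and "integrable lborel (\<lambda>x. \<phi> (w0 x))"
    and "(\<integral>x. \<phi> (w x) \<partial>lborel) \<le> (\<integral>x. \<phi> (w0 x) \<partial>lborel)" by auto
qed

text \<open>The integral of the convex function is 0 for \<open>w0\<close>, hence also for
  \<open>w\<close>, which forces it to vanish almost everywhere. The sign of \<open>M\<close>
  ensures that it vanishes on the negative axis. The case \<open>M = 0\<close> gives preservation of
  sign.\<close>

lemma convex_dominated_AE_le:
  fixes w w0 :: "'a::euclidean_space \<Rightarrow> real"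
  assumes dom: "convex_dominated w w0" and le: "AE x in lborel. w0 x \<le> M" and M: "M \<ge> 0"
  shows "AE x in lborel. w x \<le> M"
proof -
  define \<phi> where "\<phi> s = max (s - M) 0 ^ 3" for s
  define \<phi>1 where "\<phi>1 s = 3 * max (s - M) 0 ^ 2" for s
  define \<phi>2 where "\<phi>2 s = 6 * max (s - M) 0" for s
  have d: "((\<lambda>s. s - M) has_real_derivative 1) (at s)" for s
    by (auto intro!: derivative_eq_intros)
  have 1: "(\<phi> has_real_derivative \<phi>1 s) (at s)" for s
    using DERIV_chain2[OF has_real_derivative_max_power[of 1] d[of s]]
    by (simp add: \<phi>_def[abs_def] \<phi>1_def eval_nat_numeral)
  have "((\<lambda>s. max (s - M) 0 ^ 2) has_real_derivative 2 * max (s - M) 0) (at s)" for s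
    using DERIV_chain2[OF has_real_derivative_max_power[of 0] d[of s]]
    by (simp add: eval_nat_numeral)
  from DERIV_cmult[OF this, of 3] have 2: "(\<phi>1 has_real_derivative \<phi>2 s) (at s)" for s
    by (simp add: \<phi>1_def[abs_def] \<phi>2_def)
  have 3: "continuous_on UNIV \<phi>2" unfolding \<phi>2_def by (intro continuous_intros)
  note D = convex_dominatedD[OF dom 1 2 3]
  have z: "\<phi>2 s \<ge> 0" "s \<le> 0 \<Longrightarrow> \<phi> s = 0" "s \<le> 0 \<Longrightarrow> \<phi>1 s = 0" for s
    using M by (auto simp: \<phi>_def \<phi>1_def \<phi>2_def max_def)
  note D = D[OF z]
  have "(\<integral>x. \<phi> (w0 x) \<partial>lborel) = 0"
    by (rule integral_eq_zero_AE) (use le in eventually_elim, simp add: \<phi>_def)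
  then have "(\<integral>x. \<phi> (w x) \<partial>lborel) \<le> 0" using D(3) by simp
  moreover have pos: "0 \<le> \<phi> s" for s by (simp add: \<phi>_def)
  ultimately have "(\<integral>x. \<phi> (w x) \<partial>lborel) = 0"
    using Bochner_Integration.integral_nonneg[of lborel "\<lambda>x. \<phi> (w x)"] by (intro antisym) auto
  then have "AE x in lborel. \<phi> (w x) = 0"
    using D(1) pos by (simp add: integral_nonneg_eq_0_iff_AE)
  then show ?thesis
  proof eventually_elim
    case (elim x)
    then show ?case by (simp add: \<phi>_def max_def split: if_splits)
  qed
qed

text \<open>The function \<open>(s\<^sub>+\<^sup>3 + \<delta>\<^sup>3)\<^bsup>p/3\<^esup> - \<delta>\<^sup>p\<close>: the exponent \<open>3\<close> makes \<open>s\<^sub>+\<^sup>3\<close> of class \<open>C\<^sup>2\<close>, and \<open>\<delta>\<close> keeps the base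
  of the power away from \<open>0\<close>, so all \<open>p \<ge> 1\<close> are treated alike.\<close>

definition smooth_power :: "real \<Rightarrow> real \<Rightarrow> real \<Rightarrow> real" where
  "smooth_power p \<delta> s = (max s 0 ^ 3 + \<delta> ^ 3) powr (p / 3) - (\<delta> ^ 3) powr (p / 3)"

definition smooth_power' :: "real \<Rightarrow> real \<Rightarrow> real \<Rightarrow> real" where
  "smooth_power' p \<delta> s = p * max s 0 ^ 2 * (max s 0 ^ 3 + \<delta> ^ 3) powr (p / 3 - 1)"

text \<open>The factored form lets convexity be read off: for \<open>p \<ge> 1\<close> and
  \<open>\<delta> > 0\<close> each factor is nonnegative.\<close>

definition smooth_power'' :: "real \<Rightarrow> real \<Rightarrow> real \<Rightarrow> real" where
  "smooth_power'' p \<delta> s = p * max s 0 * (max s 0 ^ 3 + \<delta> ^ 3) powr (p / 3 - 2)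
     * ((p - 1) * max s 0 ^ 3 + 2 * \<delta> ^ 3)"

lemma
  assumes \<delta>: "\<delta> > 0"
  shows smooth_power_deriv: "(smooth_power p \<delta> has_real_derivative smooth_power' p \<delta> s) (at s)"
    and smooth_power'_deriv: "(smooth_power' p \<delta> has_real_derivative smooth_power'' p \<delta> s) (at s)"
    and continuous_smooth_power'': "continuous_on UNIV (smooth_power'' p \<delta>)"
proof -
  have pos: "max s 0 ^ 3 + \<delta> ^ 3 > 0" for s :: real
    using \<delta> by (intro add_nonneg_pos) auto
  have d3: "((\<lambda>s. max s 0 ^ 3 + \<delta> ^ 3) has_real_derivative 3 * max s 0 ^ 2) (at s)" for s
    using DERIV_add[OF has_real_derivative_max_power[of 1 s] DERIV_const[of "\<delta> ^ 3"]]
    by (simp add: eval_nat_numeral)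
  have d2: "((\<lambda>s. max s 0 ^ 2) has_real_derivative 2 * max s 0) (at s)" for s
    using has_real_derivative_max_power[of 0 s] by (simp add: eval_nat_numeral)
  have dp: "((\<lambda>s. (max s 0 ^ 3 + \<delta> ^ 3) powr q) has_real_derivative
      q * (max s 0 ^ 3 + \<delta> ^ 3) powr (q - 1) * (3 * max s 0 ^ 2)) (at s)" for s q
    using DERIV_fun_powr[OF d3 pos, of q s] by simp
  show "(smooth_power p \<delta> has_real_derivative smooth_power' p \<delta> s) (at s)"
    using DERIV_diff[OF dp[of "p / 3" s] DERIV_const[of "(\<delta> ^ 3) powr (p / 3)"]]
    by (simp add: smooth_power_def[abs_def] smooth_power'_def mult_ac)
  have q: "(max s 0 ^ 3 + \<delta> ^ 3) powr (p / 3 - 1)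
      = (max s 0 ^ 3 + \<delta> ^ 3) powr (p / 3 - 2) * (max s 0 ^ 3 + \<delta> ^ 3)"
    using powr_add[of "max s 0 ^ 3 + \<delta> ^ 3" "p / 3 - 2" 1] pos[of s] by simp
  have "(smooth_power' p \<delta> has_real_derivative
      p * (2 * max s 0) * (max s 0 ^ 3 + \<delta> ^ 3) powr (p / 3 - 1)
      + p * max s 0 ^ 2 * ((p / 3 - 1) * (max s 0 ^ 3 + \<delta> ^ 3) powr (p / 3 - 2) * (3 * max s 0 ^ 2))) (at s)"
    using DERIV_mult[OF DERIV_cmult[OF d2[of s], of p] dp[of "p / 3 - 1" s]]
    by (simp add: smooth_power'_def[abs_def] algebra_simps)
  also have "p * (2 * max s 0) * (max s 0 ^ 3 + \<delta> ^ 3) powr (p / 3 - 1)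
      + p * max s 0 ^ 2 * ((p / 3 - 1) * (max s 0 ^ 3 + \<delta> ^ 3) powr (p / 3 - 2) * (3 * max s 0 ^ 2))
      = smooth_power'' p \<delta> s"
    unfolding q smooth_power''_def by (simp add: algebra_simps power2_eq_square power3_eq_cube)
  finally show "(smooth_power' p \<delta> has_real_derivative smooth_power'' p \<delta> s) (at s)" .
  show "continuous_on UNIV (smooth_power'' p \<delta>)"
    unfolding smooth_power''_def[abs_def]
    by (intro continuous_intros) (metis pos less_irrefl)
qed

text \<open>Writing \<open>a\<close> for the base of the power,
  \<open>max z 0 ^ 2 \<le> a powr (2 / 3)\<close> bounds the derivative by
  \<open>p * a powr ((p - 1) / 3)\<close>. The exponent is nonnegative, so
  \<open>a \<le> M ^ 3 + 1\<close> gives a bound free of \<delta>, as dominated convergence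
  requires.\<close>

lemma smooth_power_le:
  assumes p: "p \<ge> 1" and \<delta>: "0 < \<delta>" "\<delta> \<le> 1" and s: "s \<le> M" and M: "M \<ge> 0"
  shows "\<bar>smooth_power p \<delta> s\<bar> \<le> p * (M ^ 3 + 1) powr ((p - 1) / 3) * \<bar>s\<bar>"
proof -
  have pos: "max z 0 ^ 3 + \<delta> ^ 3 > 0" for z :: real
    using \<delta> by (intro add_nonneg_pos) auto
  have bd: "norm (smooth_power' p \<delta> z) \<le> p * (M ^ 3 + 1) powr ((p - 1) / 3)" if "z \<in> {..M}" for z
  proof -
    let ?a = "max z 0 ^ 3 + \<delta> ^ 3"
    have "max z 0 ^ 2 \<le> ?a powr (2 / 3)"
    proof -
      have "max z 0 ^ 2 = (max z 0 ^ 3) powr (2 / 3)"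
        by (cases "z > 0") (simp_all add: powr_powr flip: powr_numeral)
      also have "\<dots> \<le> ?a powr (2 / 3)" using \<delta> by (intro powr_mono2) auto
      finally show ?thesis .
    qed
    then have "max z 0 ^ 2 * ?a powr (p / 3 - 1) \<le> ?a powr (2 / 3) * ?a powr (p / 3 - 1)"
      by (rule mult_right_mono) simp
    also have "\<dots> = ?a powr ((p - 1) / 3)"
      by (simp add: powr_add[symmetric] diff_divide_distrib)
    also have "\<dots> \<le> (M ^ 3 + 1) powr ((p - 1) / 3)"
      using p pos[of z] \<delta> that M by (intro powr_mono2 add_mono power_mono power_le_one) auto
    finally show ?thesis
      using p by (simp add: smooth_power'_def abs_mult mult.assoc)
  qed
  have "norm (smooth_power p \<delta> s - smooth_power p \<delta> 0) \<le> p * (M ^ 3 + 1) powr ((p - 1) / 3) * norm (s - 0)"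
    by (rule field_differentiable_bound[of "{..M}", OF _ has_field_derivative_at_within[OF smooth_power_deriv[OF \<delta>(1)]] bd])
      (use s M in auto)
  then show ?thesis by (simp add: smooth_power_def)
qed

lemma smooth_power_tendsto:
  assumes p: "p \<ge> 1" and e: "e \<longlonglongrightarrow> 0" "\<And>n. e n > 0"
  shows "(\<lambda>n. smooth_power p (e n) s) \<longlonglongrightarrow> max s 0 powr p"
proof (cases "s > 0")
  case True
  have "(\<lambda>n. (max s 0 ^ 3 + e n ^ 3) powr (p / 3)) \<longlonglongrightarrow> (max s 0 ^ 3 + 0 ^ 3) powr (p / 3)"
    using True by (intro tendsto_intros e(1)) auto
  moreover have "(max s 0 ^ 3 + 0 ^ 3) powr (p / 3) = max s 0 powr p"
    using True by (simp add: powr_powr flip: powr_numeral)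
  moreover have "(\<lambda>n. \<bar>e n ^ 3\<bar> powr (p / 3)) \<longlonglongrightarrow> 0"
    using p by (intro tendsto_zero_powrI tendsto_rabs_zero tendsto_null_power e(1) tendsto_const) auto
  then have "(\<lambda>n. (e n ^ 3) powr (p / 3)) \<longlonglongrightarrow> 0"
    using e(2) by (simp add: less_imp_le)
  ultimately have "(\<lambda>n. (max s 0 ^ 3 + e n ^ 3) powr (p / 3) - (e n ^ 3) powr (p / 3)) \<longlonglongrightarrow> max s 0 powr p - 0"
    by (intro tendsto_diff) simp_all
  then show ?thesis by (simp add: smooth_power_def)
next
  case False
  then show ?thesis by (simp add: smooth_power_def)
qed

lemma smooth_power_integral_tendsto:
  fixes v :: "'a::euclidean_space \<Rightarrow> real"
  assumes p: "p \<ge> 1" and v: "integrable lborel v" and bd: "\<And>x. \<bar>v x\<bar> \<le> M"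
    and e: "e \<longlonglongrightarrow> 0" "\<And>n. 0 < e n" "\<And>n. e n \<le> 1"
  shows "integrable lborel (\<lambda>x. max (v x) 0 powr p)"
    and "(\<lambda>n. \<integral>x. smooth_power p (e n) (v x) \<partial>lborel) \<longlonglongrightarrow> (\<integral>x. max (v x) 0 powr p \<partial>lborel)"
proof -
  have [measurable]: "v \<in> borel_measurable borel" using v by auto
  let ?w = "\<lambda>x. p * (M ^ 3 + 1) powr ((p - 1) / 3) * \<bar>v x\<bar>"
  have M: "M \<ge> 0" using bd[of 0] by linarith
  have w: "integrable lborel ?w" using v by auto
  have m: "(\<lambda>x. smooth_power p (e n) (v x)) \<in> borel_measurable lborel" for n
    unfolding smooth_power_def by measurable
  have m': "(\<lambda>x. max (v x) 0 powr p) \<in> borel_measurable lborel" by measurable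
  have lim: "AE x in lborel. (\<lambda>n. smooth_power p (e n) (v x)) \<longlonglongrightarrow> max (v x) 0 powr p"
    by (rule AE_I2) (rule smooth_power_tendsto[OF p e(1,2)])
  have le: "AE x in lborel. norm (smooth_power p (e n) (v x)) \<le> ?w x" for n
  proof (rule AE_I2)
    fix x
    have "v x \<le> M" using bd[of x] by linarith
    from smooth_power_le[OF p e(2,3) this M, of n]
    show "norm (smooth_power p (e n) (v x)) \<le> ?w x" by simp
  qed
  show "integrable lborel (\<lambda>x. max (v x) 0 powr p)"
    by (rule integrable_dominated_convergence[OF m' m w lim le])
  show "(\<lambda>n. \<integral>x. smooth_power p (e n) (v x) \<partial>lborel) \<longlonglongrightarrow> (\<integral>x. max (v x) 0 powr p \<partial>lborel)"
    by (rule integral_dominated_convergence[OF m' m w lim le])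
qed

lemma Lp_norm_positive_part:
  fixes v :: "'a::euclidean_space \<Rightarrow> real"
  assumes "p \<noteq> \<infinity>" and "integrable lborel (\<lambda>x. max (v x) 0 powr enn2real p)"
  shows "Lp_norm p (\<lambda>x. max (v x) 0)
    = ennreal ((\<integral>x. max (v x) 0 powr enn2real p \<partial>lborel) powr (1 / enn2real p))"
proof -
  have "(\<integral>\<^sup>+ x. ennreal (\<bar>max (v x) 0\<bar> powr enn2real p) \<partial>lborel)
      = ennreal (\<integral>x. max (v x) 0 powr enn2real p \<partial>lborel)"
    using nn_integral_eq_integral[OF assms(2)] by simp
  then show ?thesis
    using assms(1) by (simp add: Lp_norm_def Let_def Bochner_Integration.integral_nonneg)
qed

lemma convex_dominated_Lp_norm:
  fixes w w0 :: "'a::euclidean_space \<Rightarrow> real"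
  assumes dom: "convex_dominated w w0" and w: "integrable lborel w" and w0: "integrable lborel w0"
    and bd: "\<And>x. \<bar>w x\<bar> \<le> M" and bd0: "\<And>x. \<bar>w0 x\<bar> \<le> M" and p: "p \<ge> 1"
  shows "Lp_norm p (\<lambda>x. max (w x) 0) \<le> Lp_norm p (\<lambda>x. max (w0 x) 0)"
proof (cases "p = \<infinity>")
  case True
  have [measurable]: "w \<in> borel_measurable borel" "w0 \<in> borel_measurable borel" using w w0 by auto
  define E where "E = esssup lborel (\<lambda>x. ennreal \<bar>max (w0 x) 0\<bar>)"
  have "M \<ge> 0" using bd[of 0] by linarith
  then have "\<bar>max (w0 x) 0\<bar> \<le> M" for x using bd0[of x] by (auto simp: abs_le_iff)
  \<comment> \<open>Boundedness makes the essential supremum finite, so it is a real number that can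
    serve as the truncation level.\<close>
  then have "E \<le> ennreal M"
    unfolding E_def by (intro esssup_I AE_I2 ennreal_leI) measurable
  then obtain m where m: "m \<ge> 0" "E = ennreal m"
    by (cases E) (auto simp: top_unique)
  have "AE x in lborel. ennreal \<bar>max (w0 x) 0\<bar> \<le> E" unfolding E_def by (rule esssup_AE)
  then have "AE x in lborel. w0 x \<le> m"
    by eventually_elim (use m in \<open>auto simp: ennreal_le_iff\<close>)
  from convex_dominated_AE_le[OF dom this m(1)]
  have "AE x in lborel. ennreal \<bar>max (w x) 0\<bar> \<le> E"
    by eventually_elim (use m in \<open>auto simp: ennreal_le_iff\<close>)
  then have "esssup lborel (\<lambda>x. ennreal \<bar>max (w x) 0\<bar>) \<le> E"
    by (intro esssup_I) measurable
  then show ?thesis using True by (simp add: Lp_norm_def E_def)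
next
  case False
  define q where "q = enn2real p"
  have q: "q \<ge> 1"
    using enn2real_mono[OF p] False by (simp add: q_def less_top)
  define e where "e n = inverse (real (Suc n))" for n
  have e: "e \<longlonglongrightarrow> 0" "\<And>n. 0 < e n" "\<And>n. e n \<le> 1"
    using LIMSEQ_inverse_real_of_nat by (auto simp: e_def[abs_def] field_simps)
  note lw = smooth_power_integral_tendsto[OF q w bd e]
  note lw0 = smooth_power_integral_tendsto[OF q w0 bd0 e]
  have le: "(\<integral>x. smooth_power q (e n) (w x) \<partial>lborel) \<le> (\<integral>x. smooth_power q (e n) (w0 x) \<partial>lborel)" for n
  proof (rule convex_dominatedD(3)[OF dom smooth_power_deriv[OF e(2)] smooth_power'_deriv[OF e(2)]
        continuous_smooth_power''[OF e(2)]])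
    show "0 \<le> smooth_power'' q (e n) s" for s
      unfolding smooth_power''_def using q e(2)[of n] by (intro mult_nonneg_nonneg add_nonneg_nonneg) auto
  qed (simp_all add: smooth_power_def smooth_power'_def)
  have "(\<integral>x. max (w x) 0 powr q \<partial>lborel) \<le> (\<integral>x. max (w0 x) 0 powr q \<partial>lborel)"
    by (rule LIMSEQ_le[OF lw(2) lw0(2)]) (use le in auto)
  then have "(\<integral>x. max (w x) 0 powr q \<partial>lborel) powr (1 / q) \<le> (\<integral>x. max (w0 x) 0 powr q \<partial>lborel) powr (1 / q)"
    using q by (intro powr_mono2 Bochner_Integration.integral_nonneg) auto
  then show ?thesis
    unfolding Lp_norm_positive_part[OF False, folded q_def, OF lw(1)]
      Lp_norm_positive_part[OF False, folded q_def, OF lw0(1)]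
    by (rule ennreal_leI)
qed

text \<open>The exceptional set is open, and a nonempty open set is not negligible.\<close>

lemma AE_le_imp_le_continuous:
  fixes w :: "'a::euclidean_space \<Rightarrow> real"
  assumes "AE x in lborel. w x \<le> c" and "continuous_on UNIV w"
  shows "w x \<le> c"
proof (rule ccontr)
  assume "\<not> w x \<le> c"
  then have ne: "{x. w x > c} \<noteq> {}" by (auto simp: not_le)
  have op: "open {x. w x > c}"
    using assms(2) by (intro open_Collect_less continuous_on_const)
  have "{x. w x > c} \<in> null_sets lborel"
    using assms(1) op by (intro AE_iff_null_sets[THEN iffD2]) (auto simp: not_less)
  then have "negligible {x. w x > c}"
    by (simp add: negligible_iff_null_sets null_sets_completionI)
  then show False using open_not_negligible[OF op ne] by blast
qed

section \<open>The equation in expanded form, for \<open>u\<close> and for \<open>-u\<close>\<close>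

lemma divergence_scaleR:
  fixes G :: "'a::euclidean_space \<Rightarrow> 'a"
  assumes A: "(A has_derivative (\<lambda>h. a \<bullet> h)) (at x)" and G: "G differentiable (at x)"
  shows "(\<lambda>y. A y *\<^sub>R G y) differentiable (at x)"
    and "divergence (\<lambda>y. A y *\<^sub>R G y) x = A x * divergence G x + a \<bullet> G x"
proof -
  let ?D = "frechet_derivative G (at x)"
  have "(G has_derivative ?D) (at x)" using G by (simp add: frechet_derivative_works)
  from has_derivative_scaleR[OF A this]
  have d: "((\<lambda>y. A y *\<^sub>R G y) has_derivative (\<lambda>h. A x *\<^sub>R ?D h + (a \<bullet> h) *\<^sub>R G x)) (at x)" .
  then show "(\<lambda>y. A y *\<^sub>R G y) differentiable (at x)" unfolding differentiable_def by blast
  have "divergence (\<lambda>y. A y *\<^sub>R G y) x = (\<Sum>b\<in>Basis. (A x *\<^sub>R ?D b + (a \<bullet> b) *\<^sub>R G x) \<bullet> b)"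
    unfolding divergence_def by (simp add: frechet_derivative_at[OF d, symmetric])
  also have "\<dots> = A x * divergence G x + a \<bullet> G x"
    by (simp add: divergence_def inner_add_left sum.distrib sum_distrib_left euclidean_inner[of a "G x"])
  finally show "divergence (\<lambda>y. A y *\<^sub>R G y) x = A x * divergence G x + a \<bullet> G x" .
qed

lemma gradient_uminus:
  assumes "w differentiable (at x)"
  shows "gradient (\<lambda>x. - w x) x = - gradient w x"
  using has_derivative_minus[OF has_derivative_gradient[OF assms]]
  by (intro gradient_eqI) (simp add: inner_minus_left)

lemma has_derivative_gradient_uminus:
  assumes "\<And>x. w differentiable (at x)" and "gradient w differentiable (at x)"
  shows "(gradient (\<lambda>x. - w x) has_derivative (\<lambda>h. - frechet_derivative (gradient w) (at x) h)) (at x)"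
proof -
  have "gradient (\<lambda>x. - w x) = (\<lambda>x. - gradient w x)"
    using gradient_uminus[OF assms(1)] by (rule ext)
  moreover have "((\<lambda>x. - gradient w x) has_derivative (\<lambda>h. - frechet_derivative (gradient w) (at x) h)) (at x)"
    using assms(2) by (intro has_derivative_minus) (simp add: frechet_derivative_works)
  ultimately show ?thesis by simp
qed

lemma laplacian_uminus:
  assumes "\<And>x. w differentiable (at x)" and "gradient w differentiable (at x)"
  shows "laplacian (\<lambda>x. - w x) x = - laplacian w x"
  unfolding laplacian_def divergence_def
  by (simp add: frechet_derivative_at[OF has_derivative_gradient_uminus[OF assms], symmetric] sum_negf)

lemma deriv_uminus_real:
  assumes "f differentiable (at (t::real))"
  shows "deriv (\<lambda>s. - f s) t = - deriv f t"
  by (rule DERIV_imp_deriv) (use assms in \<open>auto intro!: derivative_eq_intros simp: DERIV_deriv_iff_real_differentiable\<close>)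

lemma C12_uminus:
  assumes "C12 u"
  shows "C12 (\<lambda>t x. - u t x)"
proof -
  have d: "(\<lambda>s. u s x) differentiable (at t)" "u t differentiable (at x)"
    "gradient (u t) differentiable (at x)" if "t > 0" for t x
    using assms that by (auto simp: C12_def)
  have 1: "continuous_on ({0<..} \<times> UNIV) (\<lambda>(t, x). deriv (\<lambda>s. - u s x) t)"
  proof -
    have "continuous_on ({0<..} \<times> UNIV) (\<lambda>z. - (case z of (t, x) \<Rightarrow> deriv (\<lambda>s. u s x) t))"
      using assms by (intro continuous_on_minus) (simp add: C12_def)
    then show ?thesis
      by (rule continuous_on_eq) (auto simp: deriv_uminus_real d)
  qed
  have 2: "continuous_on ({0<..} \<times> UNIV) (\<lambda>(t, x). gradient (\<lambda>x. - u t x) x)"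
  proof -
    have "continuous_on ({0<..} \<times> UNIV) (\<lambda>z. - (case z of (t, x) \<Rightarrow> gradient (u t) x))"
      using assms by (intro continuous_on_minus) (simp add: C12_def)
    then show ?thesis
      by (rule continuous_on_eq) (auto simp: gradient_uminus d)
  qed
  have 3: "continuous_on ({0<..} \<times> UNIV) (\<lambda>(t, x). frechet_derivative (gradient (\<lambda>x. - u t x)) (at x) h)" for h
  proof -
    have "continuous_on ({0<..} \<times> UNIV) (\<lambda>z. - (case z of (t, x) \<Rightarrow> frechet_derivative (gradient (u t)) (at x) h))"
      using assms by (intro continuous_on_minus) (simp add: C12_def)
    then show ?thesis
      by (rule continuous_on_eq)
        (auto simp: frechet_derivative_at[OF has_derivative_gradient_uminus[OF d(2,3)], symmetric])
  qed
  show ?thesis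
    unfolding C12_def
  proof (intro conjI allI impI)
    fix t :: real and x assume t: "t > 0"
    show "(\<lambda>s. - u s x) differentiable (at t)" "(\<lambda>x. - u t x) differentiable (at x)"
      using d t by (auto intro: differentiable_minus)
    show "gradient (\<lambda>x. - u t x) differentiable (at x)"
      using has_derivative_gradient_uminus[OF d(2,3)[OF t]] unfolding differentiable_def by blast
  qed (use 1 2 3 in auto)
qed

text \<open>Differentiability of the mobility at the value \<open>u t x\<close> makes the flux
  differentiable at \<open>x\<close>, so the guarded equation applies there. The product rule then
  gives the expanded form, with \<open>divergence (gradient (v t)) x\<close> replaced by
  \<open>- u t x\<close>.\<close>

lemma classical_solution_equation:
  assumes sol: "classical_solution \<alpha> \<epsilon> u0 u v" and t: "t > 0"
    and m: "((\<lambda>s. (\<epsilon> + max s 0) powr \<alpha>) has_real_derivative c) (at (u t x))"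
  shows "deriv (\<lambda>s. u s x) t = c * (gradient (u t) x \<bullet> newtonian_gradient (u t) x)
    - (\<epsilon> + max (u t x) 0) powr \<alpha> * u t x + \<epsilon> * laplacian (u t) x"
proof -
  have "u t differentiable (at x)"
    using sol t by (simp add: classical_solution_def C12_def)
  from has_derivative_compose_real[OF has_derivative_gradient[OF this] m]
  have A: "((\<lambda>y. (\<epsilon> + max (u t y) 0) powr \<alpha>) has_derivative (\<lambda>h. (c *\<^sub>R gradient (u t) x) \<bullet> h)) (at x)"
    by simp
  have G: "gradient (v t) differentiable (at x)" and L: "divergence (gradient (v t)) x = - u t x"
    using sol t unfolding classical_solution_def laplacian_def by (auto simp: minus_equation_iff)
  have N: "gradient (v t) x = newtonian_gradient (u t) x"
    using sol t by (simp add: classical_solution_def newtonian_potential_def)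
  note D = divergence_scaleR[OF A G, folded flux_def]
  have "deriv (\<lambda>s. u s x) t = divergence (flux \<alpha> \<epsilon> (u t) (v t)) x + \<epsilon> * laplacian (u t) x"
    using sol t D(1) by (simp add: classical_solution_def flux_def)
  then show ?thesis by (simp add: D(2) L N)
qed

lemma classical_solution_convex_dominated:
  assumes \<alpha>: "0 < \<alpha>" and \<epsilon>: "\<epsilon> > 0" and sol: "classical_solution \<alpha> \<epsilon> u0 u v" and t: "t \<ge> 0"
  shows "convex_dominated (u t) (u 0)" and "convex_dominated (\<lambda>x. - u t x) (\<lambda>x. - u 0 x)"
proof -
  have cont: "continuous_on ({0..} \<times> UNIV) (\<lambda>(t, x). u t x)"
    and L1: "continuous_into_L1 u" and C12: "C12 u"
    and bdd: "bounded ((\<lambda>(t, x). u t x) ` ({0..T} \<times> UNIV))" for T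
    using sol by (auto simp: classical_solution_def)
  have bd: "\<exists>M. \<forall>t\<in>{0..T}. \<forall>x. \<bar>u t x\<bar> \<le> M" for T
    using bdd[of T] by (auto simp: bounded_iff)
  \<comment> \<open>On \<open>s \<le> 0\<close> the formula for \<open>?f1\<close> is the constant
    continuous extension of the derivative from the right, not the derivative of \<open>?f\<close>
    on the negative side.\<close>
  let ?f = "\<lambda>s. (\<epsilon> + max s 0) powr \<alpha>" and ?f1 = "\<lambda>s. \<alpha> * (\<epsilon> + max s 0) powr (\<alpha> - 1)"
  have pos: "\<epsilon> + max s 0 > 0" for s using \<epsilon> by (simp add: add_pos_nonneg)
  have f: "continuous_on UNIV ?f" and f1: "continuous_on UNIV ?f1"
    using pos by (auto intro!: continuous_intros simp: less_imp_neq[symmetric])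
  have ff1: "(?f has_real_derivative ?f1 s) (at s)" if "s > 0" for s
  proof -
    have "((\<lambda>s. (\<epsilon> + s) powr \<alpha>) has_real_derivative ?f1 s) (at s)"
      using that \<epsilon> by (auto intro!: derivative_eq_intros simp: powr_diff)
    then show ?thesis
      by (rule has_field_derivative_transform_within_open[OF _ open_greaterThan[of 0]]) (use that in auto)
  qed
  show "convex_dominated (u t) (u 0)"
  proof (rule evolution_convex_dominated[OF cont bd L1 C12 f _ f1 ff1 _ _ t])
    show "deriv (\<lambda>s. u s x) t = ?f1 (u t x) * (gradient (u t) x \<bullet> newtonian_gradient (u t) x)
        - ?f (u t x) * u t x + \<epsilon> * laplacian (u t) x" if "t > 0" "u t x > 0" for t x
      by (rule classical_solution_equation[OF sol that(1) ff1[OF that(2)]])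
  qed (use \<epsilon> in auto)
  \<comment> \<open>Where \<open>- u\<close> is positive the mobility is the constant
    \<open>\<epsilon> powr \<alpha>\<close>. The drift coefficient is 0, so the Newtonian gradients
    of \<open>u\<close> and \<open>- u\<close> never have to be compared.\<close>
  show "convex_dominated (\<lambda>x. - u t x) (\<lambda>x. - u 0 x)"
  proof (rule evolution_convex_dominated[where w="\<lambda>t x. - u t x" and f="\<lambda>_. \<epsilon> powr \<alpha>" and ?f1.0="\<lambda>_. 0",
        OF _ _ _ C12_uminus[OF C12] _ _ _ _ _ _ t])
    show "continuous_on ({0..} \<times> UNIV) (\<lambda>(t, x). - u t x)"
      using continuous_on_minus[OF cont] by (simp add: case_prod_beta')
    show "\<exists>M. \<forall>t\<in>{0..T}. \<forall>x. \<bar>- u t x\<bar> \<le> M" for T using bd[of T] by simp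
    have "(\<integral>x. \<bar>- u t x - - u s x\<bar> \<partial>lborel) = (\<integral>x. \<bar>u t x - u s x\<bar> \<partial>lborel)" for t s
      by (rule Bochner_Integration.integral_cong) (auto simp: abs_minus_commute)
    then show "continuous_into_L1 (\<lambda>t x. - u t x)" using L1 by (simp add: continuous_into_L1_def)
    fix t :: real and x assume t: "t > 0" and neg: "- u t x > 0"
    \<comment> \<open>Since \<open>u t x < 0\<close>, the mobility is constant in a neighbourhood of
      that value.\<close>
    have "((\<lambda>s. \<epsilon> powr \<alpha>) has_real_derivative 0) (at (u t x))" by simp
    then have "(?f has_real_derivative 0) (at (u t x))"
      by (rule has_field_derivative_transform_within_open[OF _ open_lessThan[of 0]]) (use neg in auto)
    from classical_solution_equation[OF sol t this]
    have "deriv (\<lambda>s. u s x) t = - (\<epsilon> powr \<alpha> * u t x) + \<epsilon> * laplacian (u t) x" using neg by simp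
    moreover have "(\<lambda>s. u s x) differentiable (at t)" "\<And>x. u t differentiable (at x)"
      "gradient (u t) differentiable (at x)"
      using C12 t by (auto simp: C12_def)
    ultimately show "deriv (\<lambda>s. - u s x) t = 0 * (gradient (\<lambda>x. - u t x) x \<bullet> newtonian_gradient (\<lambda>x. - u t x) x)
        - \<epsilon> powr \<alpha> * - u t x + \<epsilon> * laplacian (\<lambda>x. - u t x) x"
      by (simp add: deriv_uminus_real laplacian_uminus)
  qed (use \<epsilon> in auto)
qed

theorem proposition6p2:
  fixes \<alpha> \<epsilon> :: real
    and u0 :: "'a::euclidean_space \<Rightarrow> real"
    and u v :: "real \<Rightarrow> 'a \<Rightarrow> real"
  assumes "0 < \<alpha>" and "\<alpha> < 1" and "\<epsilon> > 0"
    and "integrable lborel u0" and "continuous_on UNIV u0" and "bounded (range u0)"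
    and "classical_solution \<alpha> \<epsilon> u0 u v"
  shows "(\<forall>p\<ge>1. \<forall>t\<ge>0. Lp_norm p (\<lambda>x. max (u t x) 0) \<le> Lp_norm p (\<lambda>x. max (u0 x) 0)) \<and>
         (\<forall>p\<ge>1. \<forall>t\<ge>0. Lp_norm p (\<lambda>x. max (- u t x) 0) \<le> Lp_norm p (\<lambda>x. max (- u0 x) 0)) \<and>
         ((\<forall>x. u0 x \<ge> 0) \<longrightarrow> (\<forall>t\<ge>0. \<forall>x. u t x \<ge> 0))"
proof -
  have u0: "u0 = u 0" using assms(7) by (auto simp: classical_solution_def)
  note dom = classical_solution_convex_dominated[OF assms(1,3,7)]
  have int: "integrable lborel (u t)" if "t \<ge> 0" for t
    using assms(7) that by (simp add: classical_solution_def continuous_into_L1_def)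
  have bd: "\<exists>M. \<forall>s\<in>{0..t}. \<forall>x. \<bar>u s x\<bar> \<le> M" for t
  proof -
    have "bounded ((\<lambda>(t, x). u t x) ` ({0..t} \<times> UNIV))" using assms(7) by (simp add: classical_solution_def)
    then show ?thesis by (auto simp: bounded_iff)
  qed
  have Lp: "Lp_norm p (\<lambda>x. max (u t x) 0) \<le> Lp_norm p (\<lambda>x. max (u 0 x) 0)"
    "Lp_norm p (\<lambda>x. max (- u t x) 0) \<le> Lp_norm p (\<lambda>x. max (- u 0 x) 0)"
    if "p \<ge> 1" "t \<ge> 0" for p t
  proof -
    obtain M where "\<forall>s\<in>{0..t}. \<forall>x. \<bar>u s x\<bar> \<le> M" using bd by blast
    then have M: "\<bar>u t x\<bar> \<le> M" "\<bar>u 0 x\<bar> \<le> M" for x using that by auto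
    show "Lp_norm p (\<lambda>x. max (u t x) 0) \<le> Lp_norm p (\<lambda>x. max (u 0 x) 0)"
      by (rule convex_dominated_Lp_norm[OF dom(1) int int]) (use that M in auto)
    show "Lp_norm p (\<lambda>x. max (- u t x) 0) \<le> Lp_norm p (\<lambda>x. max (- u 0 x) 0)"
      by (rule convex_dominated_Lp_norm[OF dom(2)]) (use that M int in auto)
  qed
  \<comment> \<open>The upper bound 0 for \<open>- u\<close> holds at first almost everywhere;
    continuity in \<open>x\<close> extends it to every point.\<close>
  have "u t x \<ge> 0" if nn: "\<And>x. u 0 x \<ge> 0" and t: "t \<ge> 0" for t x
  proof -
    have "AE x in lborel. - u t x \<le> 0"
      by (rule convex_dominated_AE_le[OF dom(2)[OF t]]) (use nn in auto)
    moreover have "continuous_on UNIV (u t)"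
      using assms(7) t by (intro continuous_on_section[of "{0..}" u]) (auto simp: classical_solution_def)
    then have "continuous_on UNIV (\<lambda>x. - u t x)" by (intro continuous_on_minus)
    ultimately show ?thesis using AE_le_imp_le_continuous[of "\<lambda>x. - u t x" 0 x] by simp
  qed
  with Lp show ?thesis unfolding u0 by blast
qed

end
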